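(* Let $\Omega\subset\mathbb{R}^n$ be a domain, $1<p<\infty$, and for $h=1,\dots,n$ let $\mathscr{A}^h(x)$ be an $m\times m$ matrix of complex-valued locally integrable functions on $\Omega$. Suppose the operator $Au=\sum_{h=1}^n\partial_h(\mathscr{A}^h(x)\partial_hu)$ is $L^p$-dissipative. Let $z\in\mathbb{C}$. The operator $zA$ is $L^p$-dissipative if and only if $\vartheta_-\leq\arg z\leq\vartheta_+$, where $$\vartheta_-=\max_{h=1,\dots,n}\operatorname{arccot}\Big(\mathop{\mathrm{ess\,inf}}_{(x,\lambda,\omega)\in\Xi_h}\frac{Q_h(x,\lambda,\omega)}{P_h(x,\lambda,\omega)}\Big)-\pi,\qquad\vartheta_+=\min_{h=1,\dots,n}\operatorname{arccot}\Big(\mathop{\mathrm{ess\,sup}}_{(x,\lambda,\omega)\in\Xi_h}\frac{Q_h(x,\lambda,\omega)}{P_h(x,\lambda,\omega)}\Big),$$ and $$P_h(x,\lambda,\omega)=\mathrm{Re}\langle\mathscr{A}^h(x)\lambda,\lambda\rangle-(1-2/p)^2\mathrm{Re}\langle\mathscr{A}^h(x)\omega,\omega\rangle(\mathrm{Re}\langle\lambda,\omega\rangle)^2-(1-2/p)\mathrm{Re}(\langle\mathscr{A}^h(x)\omega,\lambda\rangle-\langle\mathscr{A}^h(x)\lambda,\omega\rangle)\mathrm{Re}\langle\lambda,\omega\rangle,$$ $$Q_h(x,\lambda,\omega)=\mathrm{Im}\langle\mathscr{A}^h(x)\lambda,\lambda\rangle-(1-2/p)^2\mathrm{Im}\langle\mathscr{A}^h(x)\omega,\omega\rangle(\mathrm{Re}\langle\lambda,\omega\rangle)^2-(1-2/p)\mathrm{Im}(\langle\mathscr{A}^h(x)\omega,\lambda\rangle-\langle\mathscr{A}^h(x)\lambda,\omega\rangle)\mathrm{Re}\langle\lambda,\omega\rangle,$$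 $$\Xi_h=\{(x,\lambda,\omega)\in\Omega\times\mathbb{C}^m\times\mathbb{C}^m\mid|\omega|=1,\ P_h^2(x,\lambda,\omega)+Q_h^2(x,\lambda,\omega)>0\}.$$
   Context: $\langle\cdot,\cdot\rangle$ is the standard scalar product in $\mathbb{C}^m$ (linear in the first argument) and $\partial_h=\partial/\partial x_h$. $(C_0^1(\Omega))^m$ is the space of $C^1$ functions $\Omega\to\mathbb{C}^m$ with compact support in $\Omega$. The sesquilinear form of $A$ is $\mathscr{L}(u,v)=\int_\Omega\sum_{h=1}^n\langle\mathscr{A}^h(x)\partial_hu,\partial_hv\rangle\,dx$ for $u,v\in(C_0^1(\Omega))^m$. With $p'=p/(p-1)$, $A$ is called $L^p$-dissipative if for all $u\in(C_0^1(\Omega))^m$: $\mathrm{Re}\,\mathscr{L}(u,|u|^{p-2}u)\ge0$ when $p\ge2$, and $\mathrm{Re}\,\mathscr{L}(|u|^{p'-2}u,u)\ge0$ when $1<p<2$. The operator $zA$ is the one with matrices $z\mathscr{A}^h$, and arguments are taken in $[-\pi,\pi]$. Conventions: $Q_h/P_h=+\infty$ where $P_h=0$, $Q_h>0$, and $Q_h/P_h=-\infty$ where $P_h=0$, $Q_h<0$; $0<\operatorname{arccot}y<\pi$ for real $y$, $\operatorname{arccot}(+\infty)=0$, $\operatorname{arccot}(-\infty)=\pi$; if $\Xi_h$ has measure zero, the essential infimum is $+\infty$ and the essential supremum is $-\infty$. Null sets are understood with respect to Lebesgue measure in $x$ and $\lambda$ and surface measure on the unit sphere in $\omega$.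
   Formalization: Excluded: negative real z when all P_h vanish a.e. while some Q_h is positive and some Q_h is negative on sets of positive measure; there zA is dissipative but both angles are 0, so the claim fails (e.g. p=2, m=1, A=i∂₁₁−i∂₂₂, z=−1). *)

theory Defs
  imports "HOL-Probability.Essential_Supremum"
begin

text \<open>
  The operator \<open>A u = (\<Sum>h. \<partial>\<^sub>h (A h x \<partial>\<^sub>h u))\<close> is represented by its family of coefficient
  matrices \<open>A :: 'n \<Rightarrow> real^'n \<Rightarrow> complex^'m^'m\<close>.
\<close>

definition cprod :: "complex^'m \<Rightarrow> complex^'m \<Rightarrow> complex" where
  "cprod v w = (\<Sum>i\<in>UNIV. v $ i * cnj (w $ i))"

definition partial :: "'n \<Rightarrow> (real^'n \<Rightarrow> complex^'m) \<Rightarrow> real^'n \<Rightarrow> complex^'m" where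
  "partial h u x = vector_derivative (\<lambda>t. u (x + t *\<^sub>R axis h 1)) (at 0)"

text \<open>Functions on \<open>\<Omega>\<close> with compact support in \<open>\<Omega>\<close> are identified with their extensions by zero.\<close>

definition C01 :: "(real^'n) set \<Rightarrow> (real^'n \<Rightarrow> complex^'m) set" where
  "C01 \<Omega> = {u. (\<forall>x. u differentiable (at x)) \<and> (\<forall>h. continuous_on UNIV (partial h u))
      \<and> compact (closure {x. u x \<noteq> 0}) \<and> closure {x. u x \<noteq> 0} \<subseteq> \<Omega>}"

definition locally_integrable_on :: "(real^'n \<Rightarrow> complex) \<Rightarrow> (real^'n) set \<Rightarrow> bool" where
  "locally_integrable_on f \<Omega> \<longleftrightarrow> (\<forall>K. compact K \<and> K \<subseteq> \<Omega> \<longrightarrow> set_integrable lebesgue K f)"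

definition sesq_form ::
  "(real^'n) set \<Rightarrow> ('n \<Rightarrow> real^'n \<Rightarrow> complex^'m^'m) \<Rightarrow>
    (real^'n \<Rightarrow> complex^'m) \<Rightarrow> (real^'n \<Rightarrow> complex^'m) \<Rightarrow> complex" where
  "sesq_form \<Omega> A u v =
    (LINT x:\<Omega>|lebesgue. \<Sum>h\<in>UNIV. cprod (A h x *v partial h u x) (partial h v x))"

text \<open>\<open>power_weight r u = |u|\<^bsup>r-2\<^esup> u\<close>, with value \<open>0\<close> where \<open>u = 0\<close>.\<close>

definition power_weight :: "real \<Rightarrow> (real^'n \<Rightarrow> complex^'m) \<Rightarrow> real^'n \<Rightarrow> complex^'m" where
  "power_weight r u x = (norm (u x) powr (r - 2)) *\<^sub>R u x"

definition Lp_dissipative ::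
  "real \<Rightarrow> (real^'n) set \<Rightarrow> ('n \<Rightarrow> real^'n \<Rightarrow> complex^'m^'m) \<Rightarrow> bool" where
  "Lp_dissipative p \<Omega> A \<longleftrightarrow>
    (\<forall>u \<in> C01 \<Omega>.
      (p \<ge> 2 \<longrightarrow> Re (sesq_form \<Omega> A u (power_weight p u)) \<ge> 0) \<and>
      (1 < p \<and> p < 2 \<longrightarrow> Re (sesq_form \<Omega> A (power_weight (p / (p - 1)) u) u) \<ge> 0))"

definition scale_op ::
  "complex \<Rightarrow> ('n \<Rightarrow> real^'n \<Rightarrow> complex^'m^'m) \<Rightarrow> 'n \<Rightarrow> real^'n \<Rightarrow> complex^'m^'m" where
  "scale_op z A h x = (\<chi> i j. z * A h x $ i $ j)"

definition P_fun :: "real \<Rightarrow> ('n \<Rightarrow> real^'n \<Rightarrow> complex^'m^'m) \<Rightarrow> 'n \<Rightarrow>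
    (real^'n) \<times> (complex^'m) \<times> (complex^'m) \<Rightarrow> real" where
  "P_fun p A h = (\<lambda>(x, l, w).
      Re (cprod (A h x *v l) l)
      - (1 - 2/p)^2 * Re (cprod (A h x *v w) w) * (Re (cprod l w))^2
      - (1 - 2/p) * Re (cprod (A h x *v w) l - cprod (A h x *v l) w) * Re (cprod l w))"

definition Q_fun :: "real \<Rightarrow> ('n \<Rightarrow> real^'n \<Rightarrow> complex^'m^'m) \<Rightarrow> 'n \<Rightarrow>
    (real^'n) \<times> (complex^'m) \<times> (complex^'m) \<Rightarrow> real" where
  "Q_fun p A h = (\<lambda>(x, l, w).
      Im (cprod (A h x *v l) l)
      - (1 - 2/p)^2 * Im (cprod (A h x *v w) w) * (Re (cprod l w))^2
      - (1 - 2/p) * Im (cprod (A h x *v w) l - cprod (A h x *v l) w) * Re (cprod l w))"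

definition Xi :: "real \<Rightarrow> (real^'n) set \<Rightarrow> ('n \<Rightarrow> real^'n \<Rightarrow> complex^'m^'m) \<Rightarrow> 'n \<Rightarrow>
    ((real^'n) \<times> (complex^'m) \<times> (complex^'m)) set" where
  "Xi p \<Omega> A h = {(x, l, w). x \<in> \<Omega> \<and> norm w = 1
      \<and> (P_fun p A h (x, l, w))^2 + (Q_fun p A h (x, l, w))^2 > 0}"

text \<open>
  Surface measure on the unit sphere, as the cone measure: the measure of a Borel set \<open>E\<close> of
  unit vectors equals \<open>DIM('a)\<close> times the volume of \<open>{t *\<^sub>R w | t w. 0 < t < 1 \<and> w \<in> E}\<close>.
\<close>

definition sphere_measure :: "'a::euclidean_space measure" where
  "sphere_measure = scale_measure (of_nat DIM('a))
     (distr (restrict_space lborel (ball 0 1 - {0})) (restrict_space borel (sphere 0 1)) sgn)"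

definition base_measure ::
  "(real^'n) set \<Rightarrow> ((real^'n) \<times> (complex^'m) \<times> (complex^'m)) measure" where
  "base_measure \<Omega> = lebesgue_on \<Omega> \<Otimes>\<^sub>M (lborel \<Otimes>\<^sub>M sphere_measure)"

definition Xi_measure :: "real \<Rightarrow> (real^'n) set \<Rightarrow> ('n \<Rightarrow> real^'n \<Rightarrow> complex^'m^'m) \<Rightarrow> 'n \<Rightarrow>
    ((real^'n) \<times> (complex^'m) \<times> (complex^'m)) measure" where
  "Xi_measure p \<Omega> A h = restrict_space (base_measure \<Omega>) (Xi p \<Omega> A h)"

text \<open>
  In the extended reals \<open>q / 0 = q * \<infinity>\<close>, so the quotient is \<open>\<infinity>\<close> where \<open>P = 0 < Q\<close> and
  \<open>-\<infinity>\<close> where \<open>Q < 0 = P\<close>.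
\<close>

definition QP_ratio :: "real \<Rightarrow> ('n \<Rightarrow> real^'n \<Rightarrow> complex^'m^'m) \<Rightarrow> 'n \<Rightarrow>
    (real^'n) \<times> (complex^'m) \<times> (complex^'m) \<Rightarrow> ereal" where
  "QP_ratio p A h y = ereal (Q_fun p A h y) / ereal (P_fun p A h y)"

text \<open>On a null space \<open>esssup\<close> is \<open>-\<infinity>\<close>, and hence \<open>essinf\<close> is \<open>\<infinity>\<close>.\<close>

definition essinf :: "'a measure \<Rightarrow> ('a \<Rightarrow> ereal) \<Rightarrow> ereal" where
  "essinf M f = - esssup M (\<lambda>y. - f y)"

definition arccot :: "ereal \<Rightarrow> real" where
  "arccot y = (if y = \<infinity> then 0 else if y = -\<infinity> then pi else pi / 2 - arctan (real_of_ereal y))"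

definition theta_minus ::
  "real \<Rightarrow> (real^'n) set \<Rightarrow> ('n \<Rightarrow> real^'n \<Rightarrow> complex^'m^'m) \<Rightarrow> real" where
  "theta_minus p \<Omega> A =
    Max (range (\<lambda>h. arccot (essinf (Xi_measure p \<Omega> A h) (QP_ratio p A h)))) - pi"

definition theta_plus ::
  "real \<Rightarrow> (real^'n) set \<Rightarrow> ('n \<Rightarrow> real^'n \<Rightarrow> complex^'m^'m) \<Rightarrow> real" where
  "theta_plus p \<Omega> A =
    Min (range (\<lambda>h. arccot (esssup (Xi_measure p \<Omega> A h) (QP_ratio p A h))))"

text \<open>
  \<open>arg_between a b z\<close>: some argument of \<open>z\<close> in the closed interval \<open>[-\<pi>, \<pi>]\<close> lies between
  \<open>a\<close> and \<open>b\<close>. A negative real number has the two arguments \<open>-\<pi>\<close> and \<open>\<pi>\<close>, and both are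
  needed: if \<open>P = 0\<close> and \<open>Q > 0\<close> everywhere on \<open>Xi\<close>, the admissible sector is \<open>[-\<pi>, 0]\<close>.
\<close>

definition arg_between :: "real \<Rightarrow> real \<Rightarrow> complex \<Rightarrow> bool" where
  "arg_between a b z \<longleftrightarrow>
    (\<exists>t. -pi \<le> t \<and> t \<le> pi \<and> z = of_real (cmod z) * cis t \<and> a \<le> t \<and> t \<le> b)"

text \<open>
  The degenerate situation in which \<open>A\<close> and \<open>-A\<close> are both dissipative although the sector
  \<open>[theta_minus, theta_plus]\<close> is \<open>{0}\<close>: all \<open>P\<close> vanish almost everywhere while \<open>Q\<close> takes
  both signs. An example is \<open>A u = i \<partial>\<^sub>1\<^sub>1 u - i \<partial>\<^sub>2\<^sub>2 u\<close> with \<open>p = 2\<close>. The characterization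
  of the sector of dissipativity fails there, but only for negative real \<open>z\<close>.
\<close>

definition indefinite_degenerate ::
  "real \<Rightarrow> (real^'n) set \<Rightarrow> ('n \<Rightarrow> real^'n \<Rightarrow> complex^'m^'m) \<Rightarrow> bool" where
  "indefinite_degenerate p \<Omega> A \<longleftrightarrow>
    (\<forall>h. AE y in base_measure \<Omega>. P_fun p A h y = 0) \<and>
    (\<exists>h. \<not> (AE y in base_measure \<Omega>. Q_fun p A h y \<le> 0)) \<and>
    (\<exists>h. \<not> (AE y in base_measure \<Omega>. Q_fun p A h y \<ge> 0))"

end

theory Submission
  imports Defs
begin

text \<open>
  With \<open>\<kappa> = 1 - 2/p\<close> and \<open>t = Re \<langle>\<lambda>, \<omega>\<rangle>\<close> one has
  \<open>P + \<i> Q = \<langle>A (\<lambda> - \<kappa> t \<omega>), \<lambda> + \<kappa> t \<omega>\<rangle>\<close>, and the integrand of the form at \<open>u\<close> is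
  \<open>|u|\<^bsup>q-2\<^esup> \<Sum>\<^sub>h (P\<^sub>h + \<i> Q\<^sub>h)\<close> with \<open>q = max p p'\<close>, \<open>\<omega> = u / |u|\<close> and \<open>\<lambda>\<close> obtained from
  \<open>\<partial>\<^sub>h u\<close> by an invertible rank-one correction. Hence \<open>P\<^sub>h \<ge> 0\<close> almost everywhere suffices for
  dissipativity. Conversely, test with \<open>u = \<eta> (\<omega> + s (n\<^sup>2 x\<^sub>h) \<lambda> / n)\<close> for \<open>s = sin\<close> and
  \<open>s = cos\<close>: here \<open>u\<close> tends to \<open>\<eta> \<omega>\<close>, while \<open>\<partial>\<^sub>h u / n\<close> is asymptotically
  \<open>\<eta> s' (n\<^sup>2 x\<^sub>h) \<lambda>\<close> and all other derivatives are of lower order. As \<open>sin\<^sup>2 + cos\<^sup>2 = 1\<close>, the two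
  forms divided by \<open>n\<^sup>2\<close> sum in the limit to \<open>\<integral> \<eta>\<^bsup>q\<^esup> P\<^sub>h\<close>, with \<open>\<lambda>\<close> corrected as above, which is
  therefore nonnegative for every cut-off \<open>\<eta>\<close>. Finally, the criterion for \<open>z A\<close> is \<open>Re z P\<^sub>h - Im z Q\<^sub>h \<ge> 0\<close>, a bound on
  \<open>Q\<^sub>h / P\<^sub>h\<close> by the cotangent of an argument of \<open>z\<close>.
\<close>

subsection \<open>Algebra of the integrand\<close>

text \<open>The inner product is the real one, that is \<open>Re (cprod l w)\<close> on complex
  vectors. For a unit vector w the map multiplies the real line through w by 1 + c and fixes its
  real orthogonal complement.\<close>

definition twist :: "real \<Rightarrow> 'a::real_inner \<Rightarrow> 'a \<Rightarrow> 'a" where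
  "twist c w l = l + (c * (l \<bullet> w)) *\<^sub>R w"

text \<open>The coefficients a and b stay free because the same expression occurs in two roles: as P
  + iQ with a = -(1 - 2/p) and b = 1 - 2/p, and, up to a weight, as a summand of the integrand with
  a = \<open>left_exp p\<close> and b = \<open>right_exp p\<close>.\<close>

definition dform :: "complex^'m^'m \<Rightarrow> real \<Rightarrow> real \<Rightarrow> complex^'m \<Rightarrow> complex^'m \<Rightarrow> complex" where
  "dform M a b w l = cprod (M *v twist a w l) (twist b w l)"

lemma twist_zero [simp]: "twist 0 w l = l" "twist c 0 l = l" "twist c w 0 = 0"
  by (simp_all add: twist_def)

lemma twist_add: "twist c w (l + l') = twist c w l + twist c w l'"
  by (simp add: twist_def algebra_simps inner_add_left)

lemma twist_scaleR: "twist c w (r *\<^sub>R l) = r *\<^sub>R twist c w l"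
  by (simp add: twist_def algebra_simps)

text \<open>For a unit vector w the factors on the line through w multiply: (1 + a)(1 + b) = 1 + (a
  + b + a b). For w = 0 every twist is the identity.\<close>

lemma twist_twist:
  assumes "norm w = 1 \<or> w = 0"
  shows "twist a w (twist b w l) = twist (a + b + a * b) w l"
proof -
  have "w \<bullet> w = 1 \<or> w = 0"
    using assms by (auto simp: norm_eq_1)
  then show ?thesis
    by (auto simp: twist_def inner_add_left algebra_simps)
qed

lemma norm_twist_le:
  assumes "norm w \<le> 1"
  shows "norm (twist c w l) \<le> (1 + \<bar>c\<bar>) * norm l"
proof -
  have "\<bar>l \<bullet> w\<bar> * norm w \<le> norm l * 1 * 1"
    using Cauchy_Schwarz_ineq2[of l w] assms
    by (intro mult_mono order_trans[OF Cauchy_Schwarz_ineq2] mult_left_mono) auto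
  then have "\<bar>c\<bar> * (\<bar>l \<bullet> w\<bar> * norm w) \<le> \<bar>c\<bar> * norm l"
    by (intro mult_left_mono) auto
  moreover have "norm (twist c w l) \<le> norm l + \<bar>c\<bar> * (\<bar>l \<bullet> w\<bar> * norm w)"
    unfolding twist_def by (rule order_trans[OF norm_triangle_ineq]) (simp add: abs_mult mult.assoc)
  ultimately show ?thesis
    by (simp add: algebra_simps)
qed

lemma Re_cprod: "Re (cprod v w) = v \<bullet> w"
  by (simp add: cprod_def inner_vec_def inner_complex_def)

lemma cprod_mv: "cprod (M *v x) y = (\<Sum>i\<in>UNIV. \<Sum>j\<in>UNIV. M $ i $ j * (x $ j * cnj (y $ i)))"
  by (simp add: cprod_def matrix_vector_mult_def sum_distrib_right mult.assoc)

lemma norm_cprod_mv_le: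
  "norm (cprod (M *v x) y) \<le> (\<Sum>i\<in>UNIV. \<Sum>j\<in>UNIV. norm (M $ i $ j)) * (norm x * norm y)"
  unfolding cprod_mv sum_distrib_right
  by (intro sum_norm_le)
    (simp add: norm_mult mult_left_mono mult_mono Finite_Cartesian_Product.norm_nth_le)

lemma cprod_add_left: "cprod (M *v (x + x')) y = cprod (M *v x) y + cprod (M *v x') y"
  and cprod_add_right: "cprod v (y + y') = cprod v y + cprod v y'"
  and cprod_scaleR_left: "cprod (M *v (r *\<^sub>R x)) y = of_real r * cprod (M *v x) y"
  and cprod_scaleR_right: "cprod v (r *\<^sub>R y) = of_real r * cprod v y"
  by (simp_all add: cprod_def matrix_vector_mult_def sum.distrib sum_distrib_left sum_distrib_right
      algebra_simps scaleR_conv_of_real[where 'a=complex])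

lemma dform_scale_op: "dform (scale_op z A h x) a b w l = z * dform (A h x) a b w l"
  by (simp add: dform_def cprod_mv scale_op_def sum_distrib_left mult.assoc)

lemma dform_scaleR: "dform M a b w (r *\<^sub>R l) = of_real (r\<^sup>2) * dform M a b w l"
  by (simp add: dform_def twist_scaleR cprod_scaleR_left cprod_scaleR_right power2_eq_square)

lemma dform_twist:
  assumes "norm w = 1 \<or> w = 0"
  shows "dform M a b w (twist c w l) = dform M (a + c + a * c) (b + c + b * c) w l"
  using assms by (simp add: dform_def twist_twist)

lemma norm_dform_le:
  assumes "norm w \<le> 1"
  shows "norm (dform M a b w l) \<le>
    (\<Sum>i\<in>UNIV. \<Sum>j\<in>UNIV. norm (M $ i $ j)) * ((1 + \<bar>a\<bar>) * (1 + \<bar>b\<bar>) * (norm l)\<^sup>2)"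
proof -
  have "norm (twist a w l) * norm (twist b w l) \<le> ((1 + \<bar>a\<bar>) * norm l) * ((1 + \<bar>b\<bar>) * norm l)"
    by (intro mult_mono norm_twist_le assms) auto
  also have "\<dots> = (1 + \<bar>a\<bar>) * (1 + \<bar>b\<bar>) * (norm l)\<^sup>2"
    by (simp add: power2_eq_square algebra_simps)
  finally show ?thesis
    unfolding dform_def
    by (intro order_trans[OF norm_cprod_mv_le] mult_left_mono sum_nonneg) auto
qed

lemma P_fun_eq: "P_fun p A h (x, l, w) = Re (dform (A h x) (- (1 - 2/p)) (1 - 2/p) w l)"
  and Q_fun_eq: "Q_fun p A h (x, l, w) = Im (dform (A h x) (- (1 - 2/p)) (1 - 2/p) w l)"
proof -
  define k where "k = 1 - 2/p"
  define t where "t = l \<bullet> w"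
  have "dform (A h x) (- k) k w l = cprod (A h x *v (l + (- (k * t)) *\<^sub>R w)) (l + (k * t) *\<^sub>R w)"
    by (simp add: dform_def twist_def t_def)
  also have "\<dots> = cprod (A h x *v l) l - of_real (k\<^sup>2 * t\<^sup>2) * cprod (A h x *v w) w
      - of_real (k * t) * (cprod (A h x *v w) l - cprod (A h x *v l) w)"
    unfolding cprod_add_left cprod_add_right cprod_scaleR_left cprod_scaleR_right
    by (simp add: algebra_simps power2_eq_square)
  finally have "dform (A h x) (- k) k w l = cprod (A h x *v l) l
      - of_real (k\<^sup>2 * t\<^sup>2) * cprod (A h x *v w) w
      - of_real (k * t) * (cprod (A h x *v w) l - cprod (A h x *v l) w)" .
  then show "P_fun p A h (x, l, w) = Re (dform (A h x) (- (1 - 2/p)) (1 - 2/p) w l)"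
    "Q_fun p A h (x, l, w) = Im (dform (A h x) (- (1 - 2/p)) (1 - 2/p) w l)"
    by (simp_all add: P_fun_def Q_fun_def k_def[symmetric] Re_cprod t_def[symmetric])
qed

lemma scale_op_PQ:
  "P_fun p (scale_op z A) h y = Re z * P_fun p A h y - Im z * Q_fun p A h y"
  by (cases y) (simp add: P_fun_eq Q_fun_eq dform_scale_op)

text \<open>
  The form carries \<open>power_weight\<close> on its second argument if \<open>p \<ge> 2\<close> and on its first one
  otherwise; \<open>left_exp\<close> and \<open>right_exp\<close> are the resulting coefficients of \<open>twist\<close> in the two
  arguments, and \<open>dual_exp\<close> is \<open>max p p'\<close>.
\<close>

definition dual_exp :: "real \<Rightarrow> real" where
  "dual_exp p = (if 2 \<le> p then p else p / (p - 1))"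

definition left_exp :: "real \<Rightarrow> real" where
  "left_exp p = (if 2 \<le> p then 0 else dual_exp p - 2)"

definition right_exp :: "real \<Rightarrow> real" where
  "right_exp p = (if 2 \<le> p then dual_exp p - 2 else 0)"

lemma dual_exp_ge_2: "1 < p \<Longrightarrow> 2 \<le> dual_exp p"
  by (auto simp: dual_exp_def field_simps)

text \<open>Put q = \<open>dual_exp p\<close>. In terms of the factors 1 + coefficient the claim
  reads (2/p)(q/2) = q/p and (2/p')(q/2) = q/p'. Since q is p or p', one of these numbers is 1 and
  the other is q - 1.\<close>

lemma exp_twist:
  assumes "1 < p"
  defines "k \<equiv> 1 - 2/p" and "c \<equiv> (dual_exp p - 2) / 2"
  shows "- k + c + - k * c = left_exp p" "k + c + k * c = right_exp p"
  using assms(1) by (auto simp: k_def c_def left_exp_def right_exp_def dual_exp_def field_simps)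

lemma dform_exp:
  assumes "1 < p" "norm w = 1 \<or> w = 0"
  shows "dform M (- (1 - 2/p)) (1 - 2/p) w (twist ((dual_exp p - 2) / 2) w l)
    = dform M (left_exp p) (right_exp p) w l"
  by (subst dform_twist[OF assms(2)]) (simp only: exp_twist[OF assms(1)])

text \<open>The factor 1 + c = q/2 is positive, so the twist with coefficient -c/(1 + c) is an
  inverse. This lets the necessity proof reach every \<lambda> by a suitable oscillation
  direction.\<close>

lemma twist_surj:
  assumes "1 < p" "norm w = 1"
  obtains l0 where "l = twist ((dual_exp p - 2) / 2) w l0"
proof -
  define c where "c = (dual_exp p - 2) / 2"
  have "c \<ge> 0"
    using dual_exp_ge_2[OF assms(1)] by (simp add: c_def)
  then have "c + (- c / (1 + c)) + c * (- c / (1 + c)) = 0"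
    by (simp add: field_simps)
  then have "twist c w (twist (- c / (1 + c)) w l) = l"
    by (simp add: twist_twist assms(2))
  then show thesis
    using that unfolding c_def by metis
qed

subsection \<open>The form on weighted functions\<close>

text \<open>The case distinction is needed because \<open>0 powr 0 = 0\<close>.\<close>

definition weight :: "real \<Rightarrow> real \<Rightarrow> real" where
  "weight q r = (if q = 2 then 1 else r powr (q - 2))"

lemma weight_nonneg: "0 \<le> weight q r"
  by (simp add: weight_def)

lemma weight_mult: "0 \<le> r \<Longrightarrow> 0 \<le> s \<Longrightarrow> weight q (r * s) = weight q r * weight q s"
  by (simp add: weight_def powr_mult)

lemma weight_1 [simp]: "weight q 1 = 1"
  by (simp add: weight_def)

lemma weight_mono: "2 \<le> q \<Longrightarrow> 0 \<le> r \<Longrightarrow> r \<le> s \<Longrightarrow> weight q r \<le> weight q s"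
  by (simp add: weight_def powr_mono2)

lemma continuous_on_weight: "2 \<le> q \<Longrightarrow> continuous_on {0..} (weight q)"
  unfolding weight_def[abs_def]
  by (cases "q = 2") (auto intro!: continuous_on_powr' continuous_on_id continuous_on_const)

lemma partial_eq:
  assumes "(u has_derivative u') (at x)"
  shows "partial h u x = u' (axis h 1)"
proof -
  have "((\<lambda>t. x + t *\<^sub>R axis h 1) has_vector_derivative axis h 1) (at 0)"
    by (auto intro!: derivative_eq_intros)
  from vector_derivative_diff_chain_within[OF this, where g=u and g'=u'] assms
  have "((\<lambda>t. u (x + t *\<^sub>R axis h 1)) has_vector_derivative u' (axis h 1)) (at 0)"
    by (simp add: o_def has_derivative_at_withinI)
  then show ?thesis
    unfolding partial_def by (rule vector_derivative_at)
qed

text \<open>Differentiating |u|^(q-2) produces a multiple of the real component of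
  \<open>partial h u x\<close> along u/|u|, so the product rule yields a twist with coefficient q -
  2. At a zero of u with q > 2 both sides are 0.\<close>

lemma partial_power_weight:
  assumes "u differentiable (at x)" "2 \<le> q"
  shows "partial h (power_weight q u) x
    = weight q (norm (u x)) *\<^sub>R twist (q - 2) (sgn (u x)) (partial h u x)"
proof -
  obtain u' where u': "(u has_derivative u') (at x)"
    using assms(1) by (auto simp: differentiable_def)
  consider "q = 2" | "q > 2" "u x = 0" | "q > 2" "u x \<noteq> 0"
    using assms(2) by linarith
  then show ?thesis
  proof cases
    case 1
    have "power_weight 2 u = u"
      by (auto simp: power_weight_def fun_eq_iff)
    with 1 show ?thesis
      by (simp add: weight_def)
  next
    case 2
    \<comment> \<open>With B a bound for the linear map u', the difference quotient is at most
      |u(y)|^(q-2) (o(1) + B), and its first factor tends to 0.\<close>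
    have "(power_weight q u has_derivative (\<lambda>_. 0)) (at x)"
    proof (rule has_derivativeI)
      have 1: "((\<lambda>y. norm (u y) powr (q - 2)) \<longlongrightarrow> norm (u x) powr (q - 2)) (at x)"
        using 2 has_derivative_continuous[OF u']
        by (intro tendsto_powr' tendsto_norm) (auto simp: continuous_at)
      obtain B where B: "\<And>y. norm (u' y) \<le> norm y * B" 
        using has_derivative_bounded_linear[OF u'] by (metis bounded_linear.bounded)
      have 3: "((\<lambda>y. norm (u y - u x - u' (y - x)) / norm (y - x)) \<longlongrightarrow> 0) (at x)"
        using u' by (simp add: has_derivative_iff_norm)
      have 4: "((\<lambda>y. norm (u y) powr (q - 2) * (norm (u y - u x - u' (y - x)) / norm (y - x) + B)) \<longlongrightarrow> 0 * (0 + B)) (at x)"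
        using 1 2 by (intro tendsto_intros 3) auto
      have ev: "\<forall>\<^sub>F y in at x. y \<noteq> x"
        by (simp add: eventually_at_filter)
      have "((\<lambda>y. (power_weight q u y - power_weight q u x - 0) /\<^sub>R norm (y - x)) \<longlongrightarrow> 0) (at x)"
      proof (rule Lim_null_comparison[OF _ 4[simplified]])
        show "\<forall>\<^sub>F y in at x. norm ((power_weight q u y - power_weight q u x - 0) /\<^sub>R norm (y - x))
          \<le> norm (u y) powr (q - 2) * (norm (u y - u x - u' (y - x)) / norm (y - x) + B)"
          using ev
        proof eventually_elim
          case (elim y)
          have "norm (u y) \<le> norm (u y - u x - u' (y - x)) + norm (u' (y - x))"
            using 2 norm_triangle_ineq[of "u y - u x - u' (y - x)" "u' (y - x)"] by simp
          also have "\<dots> \<le> norm (u y - u x - u' (y - x)) + norm (y - x) * B"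
            using B by simp
          finally have "norm (u y) / norm (y - x) \<le> norm (u y - u x - u' (y - x)) / norm (y - x) + B"
            using elim by (simp add: field_simps)
          then have "norm (u y) powr (q - 2) * (norm (u y) / norm (y - x)) \<le> norm (u y) powr (q - 2) * (norm (u y - u x - u' (y - x)) / norm (y - x) + B)"
            by (intro mult_left_mono) auto
          then show ?case
            using 2 by (simp add: power_weight_def divide_simps)
        qed
      qed
      then show "((\<lambda>y. (power_weight q u y - power_weight q u x - 0) /\<^sub>R norm (y - x)) \<longlongrightarrow> 0) (at x)" .
    qed simp
    from partial_eq[OF this] 2 show ?thesis
      by (simp add: weight_def)
  next
    case 3
    define r where "r = norm (u x)"
    have "r > 0" using 3 by (simp add: r_def)
    have "((\<lambda>y. norm (u y)) has_derivative (\<lambda>y. u' y \<bullet> sgn (u x))) (at x)"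
      using has_derivative_compose[OF u' has_derivative_norm[OF 3(2)]] by simp
    then have "((\<lambda>y. norm (u y) powr (q - 2)) has_derivative
        (\<lambda>y. (q - 2) * r powr (q - 3) * (u' y \<bullet> sgn (u x)))) (at x)"
      using \<open>r > 0\<close> unfolding r_def
      by (auto intro!: derivative_eq_intros simp: fun_eq_iff powr_diff field_simps eval_nat_numeral)
    then have "(power_weight q u has_derivative (\<lambda>y. norm (u x) powr (q - 2) *\<^sub>R u' y +
        ((q - 2) * r powr (q - 3) * (u' y \<bullet> sgn (u x))) *\<^sub>R u x)) (at x)"
      unfolding power_weight_def by (intro has_derivative_scaleR u') 
    from partial_eq[OF this] partial_eq[OF u']
    have "partial h (power_weight q u) x = r powr (q - 2) *\<^sub>R partial h u x +
        ((q - 2) * r powr (q - 3) * (partial h u x \<bullet> sgn (u x))) *\<^sub>R u x"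
      by (simp add: r_def)
    also have "((q - 2) * r powr (q - 3) * (partial h u x \<bullet> sgn (u x))) *\<^sub>R u x
      = ((q - 2) * r powr (q - 2) * (partial h u x \<bullet> sgn (u x))) *\<^sub>R sgn (u x)"
      using \<open>r > 0\<close> by (simp add: sgn_div_norm r_def[symmetric] powr_diff power3_eq_cube power2_eq_square field_simps)
    finally show ?thesis
      using 3 by (simp add: weight_def r_def twist_def algebra_simps)
  qed
qed

definition energy :: "real \<Rightarrow> ('n \<Rightarrow> real^'n \<Rightarrow> complex^'m^'m) \<Rightarrow> (real^'n \<Rightarrow> complex^'m) \<Rightarrow> real^'n \<Rightarrow> complex" where
  "energy p A u x = (\<Sum>h\<in>UNIV. of_real (weight (dual_exp p) (norm (u x)))
      * dform (A h x) (left_exp p) (right_exp p) (sgn (u x)) (partial h u x))"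

text \<open>The integrands agree pointwise: \<open>partial_power_weight\<close> extracts the weight
  as a real factor and leaves a twist with coefficient q - 2 on the weighted argument, while the
  other argument carries the coefficient 0.\<close>

lemma Lp_dissipative_iff_energy:
  assumes "1 < p"
  shows "Lp_dissipative p \<Omega> A \<longleftrightarrow> (\<forall>u\<in>C01 \<Omega>. 0 \<le> Re (LINT x:\<Omega>|lebesgue. energy p A u x))"
proof -
  have *: "(2 \<le> p \<longrightarrow> sesq_form \<Omega> A u (power_weight p u) = (LINT x:\<Omega>|lebesgue. energy p A u x)) \<and>
     (p < 2 \<longrightarrow> sesq_form \<Omega> A (power_weight (p / (p - 1)) u) u = (LINT x:\<Omega>|lebesgue. energy p A u x))"
    if "u \<in> C01 \<Omega>" for u
  proof -
    have d: "u differentiable (at x)" for x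
      using that by (simp add: C01_def)
    show ?thesis
      unfolding sesq_form_def energy_def dform_def 
      using dual_exp_ge_2[OF assms] partial_power_weight[OF d, of "dual_exp p"]
      by (auto simp: dual_exp_def left_exp_def right_exp_def cprod_scaleR_left cprod_scaleR_right)
  qed
  show ?thesis
    unfolding Lp_dissipative_def using * assms by (auto simp: not_le)
qed

subsection \<open>Cut-off functions\<close>

text \<open>The derivative is given through its gradient, so that its continuity is that of a
  vector-valued map.\<close>

definition C1_fun :: "(real^'n \<Rightarrow> real) \<Rightarrow> bool" where
  "C1_fun f \<longleftrightarrow> (\<exists>g. continuous_on UNIV g \<and> (\<forall>x. (f has_derivative (\<lambda>y. g x \<bullet> y)) (at x)))"

lemma C1_funE:
  assumes "C1_fun f"
  obtains g where "continuous_on UNIV g" "\<And>x. (f has_derivative (\<lambda>y. g x \<bullet> y)) (at x)"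
  using assms unfolding C1_fun_def by metis

lemma C1_fun_continuous: "C1_fun f \<Longrightarrow> continuous_on S f"
  by (metis C1_funE continuous_at_imp_continuous_on has_derivative_continuous)

lemma C1_fun_const: "C1_fun (\<lambda>x. c)"
  unfolding C1_fun_def by (rule exI[of _ "\<lambda>x. 0"]) (simp add: inner_zero_left[abs_def])

lemma C1_fun_coord: "C1_fun (\<lambda>x::real^'n. x $ i)"
proof -
  have "(\<lambda>y. axis i 1 \<bullet> y) = (\<lambda>y::real^'n. y $ i)"
    by (simp add: fun_eq_iff inner_axis')
  then have "((\<lambda>x::real^'n. x $ i) has_derivative (\<lambda>y. axis i 1 \<bullet> y)) (at x)" for x
    by (simp add: bounded_linear_imp_has_derivative bounded_linear_vec_nth)
  then show ?thesis
    unfolding C1_fun_def by (intro exI[of _ "\<lambda>x. axis i 1"]) (auto simp: continuous_on_const)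
qed

lemma C1_fun_add:
  assumes "C1_fun f" "C1_fun f'"
  shows "C1_fun (\<lambda>x. f x + f' x)"
proof -
  obtain g g' where g: "continuous_on UNIV g" "\<And>x. (f has_derivative (\<lambda>y. g x \<bullet> y)) (at x)"
    "continuous_on UNIV g'" "\<And>x. (f' has_derivative (\<lambda>y. g' x \<bullet> y)) (at x)"
    using assms by (metis C1_funE)
  have "((\<lambda>x. f x + f' x) has_derivative (\<lambda>y. (g x + g' x) \<bullet> y)) (at x)" for x
    by (rule has_derivative_eq_rhs[OF has_derivative_add[OF g(2,4)]]) (simp add: fun_eq_iff inner_add_left)
  moreover have "continuous_on UNIV (\<lambda>x. g x + g' x)"
    by (intro continuous_intros g)
  ultimately show ?thesis
    unfolding C1_fun_def by blast
qed

lemma C1_fun_mult: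
  assumes "C1_fun f" "C1_fun f'"
  shows "C1_fun (\<lambda>x. f x * f' x)"
proof -
  obtain g g' where g: "continuous_on UNIV g" "\<And>x. (f has_derivative (\<lambda>y. g x \<bullet> y)) (at x)"
    "continuous_on UNIV g'" "\<And>x. (f' has_derivative (\<lambda>y. g' x \<bullet> y)) (at x)"
    using assms by (metis C1_funE)
  have "((\<lambda>x. f x * f' x) has_derivative (\<lambda>y. (f x *\<^sub>R g' x + f' x *\<^sub>R g x) \<bullet> y)) (at x)" for x
    by (rule has_derivative_eq_rhs[OF has_derivative_mult[OF g(2,4)]])
      (simp add: fun_eq_iff inner_add_left)
  moreover have "continuous_on UNIV (\<lambda>x. f x *\<^sub>R g' x + f' x *\<^sub>R g x)"
    by (intro continuous_intros C1_fun_continuous assms g)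
  ultimately show ?thesis
    unfolding C1_fun_def by blast
qed

lemma C1_fun_compose:
  assumes "C1_fun f" "\<And>x. (\<phi> has_real_derivative \<phi>' (f x)) (at (f x))" "continuous_on (range f) \<phi>'"
  shows "C1_fun (\<lambda>x. \<phi> (f x))"
proof -
  obtain g where g: "continuous_on UNIV g" "\<And>x. (f has_derivative (\<lambda>y. g x \<bullet> y)) (at x)"
    using assms(1) by (metis C1_funE)
  have "((\<lambda>x. \<phi> (f x)) has_derivative (\<lambda>y. (\<phi>' (f x) *\<^sub>R g x) \<bullet> y)) (at x)" for x
    using has_derivative_compose[OF g(2) assms(2)[unfolded has_field_derivative_def]] by simp
  moreover have "continuous_on UNIV (\<lambda>x. \<phi>' (f x) *\<^sub>R g x)"
    using g by (intro continuous_intros continuous_on_compose2[OF assms(3)] C1_fun_continuous assms(1)) auto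
  ultimately show ?thesis
    unfolding C1_fun_def by blast
qed

lemma C1_fun_sum: "finite I \<Longrightarrow> (\<And>i. i \<in> I \<Longrightarrow> C1_fun (f i)) \<Longrightarrow> C1_fun (\<lambda>x. \<Sum>i\<in>I. f i x)"
  by (induction I rule: finite_induct) (auto intro: C1_fun_const C1_fun_add)

lemma C1_fun_prod: "finite I \<Longrightarrow> (\<And>i. i \<in> I \<Longrightarrow> C1_fun (f i)) \<Longrightarrow> C1_fun (\<lambda>x. \<Prod>i\<in>I. f i x)"
  by (induction I rule: finite_induct) (auto intro: C1_fun_const C1_fun_mult)

text \<open>The building block of the cut-offs: a function with continuous derivative that is
  positive exactly for t > 0. At 0 the difference quotient is bounded by |h|.\<close>

lemma DERIV_pos_part_square:
  "((\<lambda>t. (max 0 t)\<^sup>2) has_real_derivative 2 * max 0 t) (at (t::real))"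
proof -
  consider "t > 0" | "t < 0" | "t = 0" by linarith
  then show ?thesis
  proof cases
    case 1
    have "((\<lambda>t. t\<^sup>2) has_real_derivative 2 * t) (at t)"
      by (auto intro!: derivative_eq_intros)
    then have "((\<lambda>t. (max 0 t)\<^sup>2) has_real_derivative 2 * t) (at t)"
      by (rule has_field_derivative_transform_within_open[of _ _ _ "{0<..}"]) (use 1 in auto)
    with 1 show ?thesis by simp
  next
    case 2
    have "((\<lambda>t. 0) has_real_derivative 0) (at t)"
      by simp
    then have "((\<lambda>t. (max 0 t)\<^sup>2) has_real_derivative 0) (at t)"
      by (rule has_field_derivative_transform_within_open[of _ _ _ "{..<0}"]) (use 2 in auto)
    with 2 show ?thesis by simp
  next
    case 3
    have "((\<lambda>h::real. (max 0 h)\<^sup>2 / h) \<longlongrightarrow> 0) (at 0)"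
      by (rule Lim_null_comparison[of _ "\<lambda>h. \<bar>h\<bar>"])
        (auto intro!: tendsto_eq_intros always_eventually simp: max_def power2_eq_square)
    with 3 show ?thesis
      by (simp add: DERIV_def)
  qed
qed

lemma C1_fun_pos_part_square:
  assumes "C1_fun f"
  shows "C1_fun (\<lambda>x. (max 0 (f x))\<^sup>2)"
  by (rule C1_fun_compose[OF assms, where \<phi>'="\<lambda>t. 2 * max 0 t"])
    (auto intro!: DERIV_pos_part_square continuous_intros)

text \<open>A product of squared positive parts over the coordinates vanishes as soon as x leaves
  one of the slabs a_i < x_i < b_i.\<close>

lemma C1_box_bump:
  fixes a b :: "real^'n"
  obtains f where "C1_fun f" "\<And>x. 0 \<le> f x" "\<And>x. 0 < f x \<longleftrightarrow> x \<in> box a b"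
proof -
  define f where "f x = (\<Prod>i\<in>UNIV. (max 0 (x $ i + - a $ i))\<^sup>2 * (max 0 (b $ i + (-1) * x $ i))\<^sup>2)"
    for x :: "real^'n"
  have 0: "0 \<le> f x" for x
    unfolding f_def by (intro prod_nonneg) auto
  have "f x \<noteq> 0 \<longleftrightarrow> x \<in> box a b" for x
    unfolding f_def by (simp add: mem_box_cart) (smt (verit, best))
  with 0 have "0 < f x \<longleftrightarrow> x \<in> box a b" for x
    by (metis less_le)
  moreover have "C1_fun f"
    unfolding f_def
    by (intro C1_fun_prod C1_fun_mult C1_fun_pos_part_square C1_fun_add C1_fun_coord C1_fun_const) auto
  ultimately show thesis
    using that 0 by blast
qed

text \<open>Finitely many box bumps supported in U have a sum g that is positive on the compact set
  S. Scaling g up and composing with t/(1 + t) brings the values below 1 everywhere and close to 1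
  on S.\<close>

lemma C1_cutoff:
  fixes S U :: "(real^'n) set"
  assumes "compact S" "open U" "S \<subseteq> U" "0 < d"
  obtains f where "C1_fun f" "\<And>x. 0 \<le> f x" "\<And>x. f x \<le> 1" "\<And>x. x \<notin> U \<Longrightarrow> f x = 0"
    "\<And>x. x \<in> S \<Longrightarrow> 1 - d \<le> f x"
proof (cases "S = {}")
  case True
  then show thesis
    using that[OF C1_fun_const[of 0]] by simp
next
  case False
  have "\<exists>f. C1_fun f \<and> (\<forall>y. 0 \<le> f y) \<and> (\<forall>y. y \<notin> U \<longrightarrow> f y = 0) \<and> 0 < f x" if "x \<in> S" for x
  proof -
    obtain a b where ab: "x \<in> box a b" "box a b \<subseteq> U"
      using assms(2,3) \<open>x \<in> S\<close> open_contains_box[of U x] by (metis order_trans subset_iff)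
    obtain f where "C1_fun f" "\<And>x. 0 \<le> f x" "\<And>x. 0 < f x \<longleftrightarrow> x \<in> box a b"
      using C1_box_bump by blast
    with ab show ?thesis
      by (metis less_le subsetD)
  qed
  then obtain F where F: "\<And>x. x \<in> S \<Longrightarrow> C1_fun (F x)" "\<And>x y. x \<in> S \<Longrightarrow> 0 \<le> F x y"
    "\<And>x y. x \<in> S \<Longrightarrow> y \<notin> U \<Longrightarrow> F x y = 0" "\<And>x. x \<in> S \<Longrightarrow> 0 < F x x"
    by metis
  have "open {y. 0 < F x y}" if "x \<in> S" for x
    using F(1)[OF that] by (intro open_Collect_less continuous_intros C1_fun_continuous)
  then obtain T where T: "T \<subseteq> S" "finite T" "S \<subseteq> (\<Union>x\<in>T. {y. 0 < F x y})"
  proof (rule compactE_image[OF assms(1), of S "\<lambda>x. {y. 0 < F x y}"])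
    show "S \<subseteq> (\<Union>x\<in>S. {y. 0 < F x y})"
      using F(4) by blast
  qed auto
  define g where "g y = (\<Sum>x\<in>T. F x y)" for y
  have g: "C1_fun g" "\<And>y. 0 \<le> g y" "\<And>y. y \<notin> U \<Longrightarrow> g y = 0"
    using T(1,2) F unfolding g_def by (auto intro!: C1_fun_sum sum_nonneg sum.neutral)
  have pos: "0 < g y" if "y \<in> S" for y
  proof -
    obtain x where "x \<in> T" "0 < F x y" using T(3) \<open>y \<in> S\<close> by auto
    then show ?thesis
      unfolding g_def using T(1,2) F(2) by (intro sum_pos2[of _ x]) auto
  qed
  obtain x0 where x0: "x0 \<in> S" "\<And>y. y \<in> S \<Longrightarrow> g x0 \<le> g y"
    using continuous_attains_inf[OF assms(1) False C1_fun_continuous[OF g(1)]] by blast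
  \<comment> \<open>Chosen so that k g is at least 1/d on S; then 1 - f = 1/(1 + k g) is at most d
    there.\<close>
  define k where "k = 1 / (d * g x0)"
  have k: "0 < k" using assms(4) pos[OF x0(1)] by (simp add: k_def)
  define f where "f x = (k * g x) / (1 + k * g x)" for x
  have kg: "0 \<le> k * g x" for x using g(2) k by simp
  have "C1_fun f"
    unfolding f_def
  proof (rule C1_fun_compose[where \<phi>="\<lambda>t. t / (1 + t)" and \<phi>'="\<lambda>t. 1 / (1 + t)\<^sup>2"])
    show "C1_fun (\<lambda>x. k * g x)"
      by (intro C1_fun_mult C1_fun_const g(1))
    have nz: "1 + k * g x \<noteq> 0" for x using kg[of x] by linarith
    then show "((\<lambda>t. t / (1 + t)) has_real_derivative 1 / (1 + k * g x)\<^sup>2) (at (k * g x))" for x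
      by (auto intro!: derivative_eq_intros simp: power2_eq_square field_simps)
    show "continuous_on (range (\<lambda>x. k * g x)) (\<lambda>t. 1 / (1 + t)\<^sup>2)"
      using nz by (auto intro!: continuous_intros)
  qed
  moreover have "0 \<le> f x" "f x \<le> 1" for x
    using kg[of x] by (auto simp: f_def divide_simps)
  moreover have "f x = 0" if "x \<notin> U" for x
    using g(3)[OF that] by (simp add: f_def)
  moreover have "1 - d \<le> f x" if "x \<in> S" for x
  proof -
    have "1 / d = k * g x0"
      using pos[OF x0(1)] assms(4) by (simp add: k_def)
    also have "\<dots> \<le> k * g x"
      using x0(2)[OF that] k by simp
    finally have "1 \<le> d * (k * g x)"
      using assms(4) by (simp add: field_simps)
    then have "1 \<le> d * (1 + k * g x)"
      using assms(4) by (simp add: algebra_simps)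
    then show ?thesis
      using kg[of x] by (simp add: f_def field_simps)
  qed
  ultimately show thesis
    using that by blast
qed

text \<open>Cut-offs for neighbourhoods of S that shrink to S, with error 1/(n+1) on S. All of them
  vanish off one compact set K, which later provides a common majorant.\<close>

lemma C1_approx_indicator:
  fixes S \<Omega> :: "(real^'n) set"
  assumes "compact S" "open \<Omega>" "S \<subseteq> \<Omega>"
  obtains K f where "compact K" "K \<subseteq> \<Omega>" "\<And>n::nat. C1_fun (f n)" "\<And>n x. 0 \<le> f n x" "\<And>n x. f n x \<le> 1"
    "\<And>n x. x \<notin> K \<Longrightarrow> f n x = 0" "\<And>x. (\<lambda>n. f n x) \<longlonglongrightarrow> indicat_real S x"
proof -
  obtain e where e: "e > 0" "(\<Union>x\<in>S. cball x e) \<subseteq> \<Omega>"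
    using compact_subset_open_imp_cball_epsilon_subset[OF assms] by blast
  define K where "K = (\<Union>x\<in>S. cball x e)"
  \<comment> \<open>K is the Minkowski sum of S and a closed ball, hence compact.\<close>
  have "K = (\<Union>x\<in>S. \<Union>y\<in>cball 0 e. {x + y})"
    unfolding K_def
  proof (intro SUP_cong refl)
    show "cball x e = (\<Union>y\<in>cball 0 e. {x + y})" for x :: "real^'n"
      using image_add_cball[of x 0 e] by (simp only: UNION_singleton_eq_range add_0_left)
  qed
  then have "compact K"
    using compact_sums'[OF assms(1) compact_cball[of 0 e]] by simp
  define U where "U n = (\<Union>x\<in>S. ball x (e / real (Suc n)))" for n
  have "\<exists>f. C1_fun f \<and> (\<forall>x. 0 \<le> f x) \<and> (\<forall>x. f x \<le> 1) \<and> (\<forall>x. x \<notin> U n \<longrightarrow> f x = 0) \<and>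
    (\<forall>x\<in>S. 1 - 1 / real (Suc n) \<le> f x)" for n
  proof -
    have "S \<subseteq> U n" using e(1) by (auto simp: U_def intro!: bexI)
    moreover have "open (U n)" by (auto simp: U_def)
    ultimately obtain f where "C1_fun f" "\<And>x. 0 \<le> f x" "\<And>x. f x \<le> 1" "\<And>x. x \<notin> U n \<Longrightarrow> f x = 0"
    "\<And>x. x \<in> S \<Longrightarrow> 1 - 1 / real (Suc n) \<le> f x"
      using C1_cutoff[OF assms(1), of "U n" "1 / real (Suc n)"] by (metis of_nat_0_less_iff zero_less_Suc zero_less_divide_1_iff)
    then show ?thesis by blast
  qed
  then obtain f where f: "\<And>n. C1_fun (f n)" "\<And>n x. 0 \<le> f n x" "\<And>n x. f n x \<le> 1"
    "\<And>n x. x \<notin> U n \<Longrightarrow> f n x = 0" "\<And>n x. x \<in> S \<Longrightarrow> 1 - 1 / real (Suc n) \<le> f n x"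
    by metis
  have UK: "U n \<subseteq> K" for n
  proof -
    have "e / real (Suc n) \<le> e" using e(1) by (simp add: field_simps)
    then show ?thesis
      unfolding U_def K_def
      by (intro UN_mono order_refl order_trans[OF ball_subset_cball subset_cball])
  qed
  have "(\<lambda>n. f n x) \<longlonglongrightarrow> indicat_real S x" for x
  proof (cases "x \<in> S")
    case True
    have "(\<lambda>n. 1 - 1 / real (Suc n)) \<longlonglongrightarrow> 1 - 0"
      by (intro tendsto_intros LIMSEQ_Suc[OF lim_1_over_n])
    then have lim: "(\<lambda>n. 1 - 1 / real (Suc n)) \<longlonglongrightarrow> 1"
      by simp
    have "\<forall>n. 1 - 1 / real (Suc n) \<le> f n x" "\<forall>n. f n x \<le> 1"
      using f(3) f(5)[OF True] by blast+
    then have "(\<lambda>n. f n x) \<longlonglongrightarrow> 1"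
      by (rule tendsto_sandwich[OF always_eventually always_eventually lim tendsto_const])
    with True show ?thesis by simp
  next
    case False
    obtain r where r: "r > 0" "ball x r \<subseteq> - S"
      using False assms(1) by (metis ComplI compact_imp_closed open_Compl open_contains_ball)
    have "(\<lambda>n. e * (1 / real (Suc n))) \<longlonglongrightarrow> e * 0"
      by (intro tendsto_intros LIMSEQ_Suc[OF lim_1_over_n])
    then have "\<forall>\<^sub>F n in sequentially. e * (1 / real (Suc n)) < r"
      using r(1) by (intro order_tendstoD(2)) auto
    then have "\<forall>\<^sub>F n in sequentially. f n x = 0"
    proof eventually_elim
      case (elim n)
      have "x \<notin> U n"
      proof
        assume "x \<in> U n"
        then obtain y where "y \<in> S" "dist x y < r"
          using elim by (auto simp: U_def dist_commute)
        then show False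
          using r(2) by auto
      qed
      then show ?case by (rule f(4))
    qed
    then have "(\<lambda>n. f n x) \<longlonglongrightarrow> 0"
      by (rule tendsto_eventually)
    with False show ?thesis by simp
  qed
  moreover have "f n x = 0" if "x \<notin> K" for n x
    using f(4) UK that by blast
  ultimately show thesis
    using that[of K f] \<open>compact K\<close> e(2) f(1-3) unfolding K_def by blast
qed

subsection \<open>Locally integrable functions\<close>

text \<open>An exhaustion of the open set by compact sets exhibits the restricted function as a
  pointwise limit of integrable ones.\<close>

lemma borel_measurable_of_compact_pieces:
  fixes f :: "'a::euclidean_space \<Rightarrow> 'b::euclidean_space"
  assumes "open \<Omega>" "\<And>K. compact K \<Longrightarrow> K \<subseteq> \<Omega> \<Longrightarrow> set_integrable lebesgue K f"
  shows "(\<lambda>x. indicator \<Omega> x *\<^sub>R f x) \<in> borel_measurable lebesgue"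
proof -
  obtain C :: "nat \<Rightarrow> 'a set" where C: "\<And>n. compact (C n)" "\<And>n. C n \<subseteq> \<Omega>" "\<And>n. C n \<subseteq> interior (C (Suc n))" "\<Union>(range C) = \<Omega>"
    using open_Union_compact_subsets[OF assms(1)] by metis
  have inc: "C m \<subseteq> C n" if "m \<le> n" for m n
    using that by (rule lift_Suc_mono_le[of C, OF order_trans[OF C(3) interior_subset]])
  show ?thesis
  proof (rule borel_measurable_LIMSEQ_metric)
    show "(\<lambda>x. indicator (C n) x *\<^sub>R f x) \<in> borel_measurable lebesgue" for n
      using assms(2)[OF C(1,2)] unfolding set_integrable_def by auto
    show "(\<lambda>n. indicator (C n) x *\<^sub>R f x) \<longlonglongrightarrow> indicator \<Omega> x *\<^sub>R f x" for x
    proof (cases "x \<in> \<Omega>")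
      case True
      then obtain m where "x \<in> C m" using C(4) by auto
      then have "\<forall>n\<ge>m. x \<in> C n" using inc by blast
      then show ?thesis
        using True by (intro tendsto_eventually eventually_sequentiallyI[of m]) auto
    next
      case False
      then have "x \<notin> C n" for n using C(2) by blast
      then show ?thesis using False by simp
    qed
  qed
qed

text \<open>On a compact subset S of the set where f < 0, cut-offs tending to the indicator of S
  give a nonnegative integral of f over S, so S is null. Such sets S exhaust the negative set up to
  a null set. The function \<theta> accounts for the power of the cut-off that the form
  produces.\<close>

lemma AE_nonneg_of_cutoff_integrals:
  fixes f :: "real^'n \<Rightarrow> real" and \<theta> :: "real \<Rightarrow> real"
  assumes "open \<Omega>" and int: "\<And>K. compact K \<Longrightarrow> K \<subseteq> \<Omega> \<Longrightarrow> set_integrable lebesgue K f"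
    and \<theta>: "continuous_on {0..1} \<theta>" "\<theta> 0 = 0" "\<theta> 1 = 1"
    and ge: "\<And>\<eta> K. C1_fun \<eta> \<Longrightarrow> (\<And>x. 0 \<le> \<eta> x) \<Longrightarrow> (\<And>x. \<eta> x \<le> 1) \<Longrightarrow> compact K \<Longrightarrow> K \<subseteq> \<Omega> \<Longrightarrow>
      (\<And>x. x \<notin> K \<Longrightarrow> \<eta> x = 0) \<Longrightarrow> 0 \<le> (\<integral>x. \<theta> (\<eta> x) * f x \<partial>lebesgue)"
  shows "AE x in lebesgue. x \<in> \<Omega> \<longrightarrow> 0 \<le> f x"
proof -
  have cpt: "S \<in> null_sets lebesgue" if S: "compact S" "S \<subseteq> {x\<in>\<Omega>. f x < 0}" for S
  proof -
    have "S \<subseteq> \<Omega>" using S by blast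
    then obtain K \<eta> where K: "compact K" "K \<subseteq> \<Omega>" and \<eta>: "\<And>n::nat. C1_fun (\<eta> n)" "\<And>n x. 0 \<le> \<eta> n x" "\<And>n x. \<eta> n x \<le> 1"
      "\<And>n x. x \<notin> K \<Longrightarrow> \<eta> n x = 0" "\<And>x. (\<lambda>n. \<eta> n x) \<longlonglongrightarrow> indicat_real S x"
      using C1_approx_indicator[OF S(1) assms(1)] by metis
    have intK: "integrable lebesgue (\<lambda>x. indicator K x * f x)"
      using int[OF K] by (simp add: set_integrable_def)
    have intS: "integrable lebesgue (\<lambda>x. indicator S x * f x)"
      using int[OF S(1) \<open>S \<subseteq> \<Omega>\<close>] by (simp add: set_integrable_def)
    obtain B where "\<forall>y\<in>\<theta> ` {0..1}. norm y \<le> B"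
      using compact_imp_bounded[OF compact_continuous_image[OF \<theta>(1) compact_Icc]]
      unfolding bounded_iff by blast
    then have B: "\<bar>\<theta> t\<bar> \<le> B" if "t \<in> {0..1}" for t
      using that by simp
    have eq: "\<theta> (\<eta> n x) * f x = \<theta> (\<eta> n x) * (indicator K x * f x)" for n x
      using \<eta>(4) \<theta>(2) by (cases "x \<in> K") auto
    have meas: "(\<lambda>x. \<theta> (\<eta> n x)) \<in> borel_measurable lebesgue" for n
    proof -
      have "continuous_on UNIV (\<lambda>x. \<theta> (\<eta> n x))"
        by (rule continuous_on_compose2[OF \<theta>(1) C1_fun_continuous[OF \<eta>(1)]]) (use \<eta>(2,3) in auto)
      then show ?thesis
        by (intro measurable_completion) (simp add: borel_measurable_continuous_onI)
    qed
    have "(\<lambda>n. \<integral>x. \<theta> (\<eta> n x) * f x \<partial>lebesgue) \<longlonglongrightarrow> (\<integral>x. indicator S x * f x \<partial>lebesgue)"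
      unfolding eq
    proof (rule integral_dominated_convergence[where w="\<lambda>x. B * \<bar>indicator K x * f x\<bar>"])
      show "(\<lambda>x. indicator S x * f x) \<in> borel_measurable lebesgue"
        using intS by auto
      show "(\<lambda>x. \<theta> (\<eta> n x) * (indicator K x * f x)) \<in> borel_measurable lebesgue" for n
        using meas borel_measurable_integrable[OF intK] by (rule borel_measurable_times)
      show "integrable lebesgue (\<lambda>x. B * \<bar>indicator K x * f x\<bar>)"
        using intK by simp
      show "AE x in lebesgue. norm (\<theta> (\<eta> n x) * (indicator K x * f x)) \<le> B * \<bar>indicator K x * f x\<bar>" for n
        unfolding real_norm_def abs_mult[of "\<theta> _"] using B \<eta>(2,3)
        by (intro AE_I2 mult_right_mono) auto
      have "(\<lambda>n. \<theta> (\<eta> n x)) \<longlonglongrightarrow> \<theta> (indicat_real S x)" for x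
        by (rule continuous_on_tendsto_compose[OF \<theta>(1) \<eta>(5)])
          (use \<eta>(2,3) in \<open>auto simp: indicator_def intro!: always_eventually\<close>)
      then have "(\<lambda>n. \<theta> (\<eta> n x) * (indicator K x * f x)) \<longlonglongrightarrow> \<theta> (indicat_real S x) * (indicator K x * f x)" for x
        by (intro tendsto_intros)
      moreover have "\<theta> (indicat_real S x) * (indicator K x * f x) = indicator S x * f x" for x
      proof (cases "x \<in> K")
        case False
        then have "indicat_real S x = 0"
          using \<eta>(5)[of x] by (simp add: \<eta>(4)[OF False] LIMSEQ_const_iff del: indicator_eq_0_iff)
        then show ?thesis by (simp add: \<theta>)
      qed (auto simp: indicator_def \<theta>)
      ultimately show "AE x in lebesgue. (\<lambda>n. \<theta> (\<eta> n x) * (indicator K x * f x)) \<longlonglongrightarrow> indicator S x * f x"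
        by simp
    qed
    then have "0 \<le> (\<integral>x. indicator S x * f x \<partial>lebesgue)"
      using ge[OF \<eta>(1-3) K \<eta>(4)] by (intro LIMSEQ_le_const) auto
    moreover have neg: "0 \<le> - (indicator S x * f x)" for x
      using S(2) by (auto simp: indicator_def intro: less_imp_le)
    then have "0 \<le> (\<integral>x. - (indicator S x * f x) \<partial>lebesgue)"
      by (rule Bochner_Integration.integral_nonneg)
    ultimately have "(\<integral>x. - (indicator S x * f x) \<partial>lebesgue) = 0"
      by simp
    then have "AE x in lebesgue. - (indicator S x * f x) = 0"
      using neg intS by (subst (asm) integral_nonneg_eq_0_iff_AE) auto
    then have "AE x in lebesgue. x \<notin> S"
      by eventually_elim (use S(2) in \<open>auto simp: indicator_def split: if_splits\<close>)
    then show ?thesis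
      using S(1) by (subst AE_iff_null_sets) (auto intro: lmeasurable_compact fmeasurableD)
  qed
  have "{x\<in>\<Omega>. f x < 0} = {x \<in> space lebesgue. indicator \<Omega> x *\<^sub>R f x < 0}"
    by (auto simp: indicator_def)
  also have "\<dots> \<in> sets lebesgue"
    using borel_measurable_of_compact_pieces[OF assms(1) int] by measurable
  finally have "{x\<in>\<Omega>. f x < 0} \<in> sets lebesgue" .
  \<comment> \<open>Inner regularity: a Lebesgue set is an F-sigma set up to a null set, and an
    F-sigma set is a countable union of compact sets.\<close>
  then obtain C T
    where CT: "fsigma C" "T \<in> null_sets lebesgue" "C \<union> T = {x\<in>\<Omega>. f x < 0}" "disjnt C T"
    by (rule lebesgue_set_almost_fsigma)
  from CT(1) obtain F :: "nat \<Rightarrow> (real^'n) set" where F: "range F \<subseteq> Collect compact" "C = \<Union>(range F)"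
    unfolding fsigma_Union_compact by blast
  have "F n \<in> null_sets lebesgue" for n
    using F CT(3) by (intro cpt) auto
  then have "C \<in> null_sets lebesgue"
    unfolding F(2) by (rule null_sets_UN)
  then have "{x\<in>\<Omega>. f x < 0} \<in> null_sets lebesgue"
    unfolding CT(3)[symmetric] using CT(2) by (rule null_sets.Un)
  then show ?thesis
    by (rule AE_I') auto
qed

subsection \<open>Oscillating test functions\<close>

lemma tendsto_cprod_mv [tendsto_intros]:
  assumes "(f \<longlongrightarrow> a) F" "(g \<longlongrightarrow> b) F"
  shows "((\<lambda>x. cprod (M *v f x) (g x)) \<longlongrightarrow> cprod (M *v a) b) F"
  unfolding cprod_mv by (intro tendsto_intros assms)

lemma tendsto_twist [tendsto_intros]:
  assumes "(f \<longlongrightarrow> a) F" "(g \<longlongrightarrow> b) F"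
  shows "((\<lambda>x. twist c (f x) (g x)) \<longlongrightarrow> twist c a b) F"
  unfolding twist_def by (intro tendsto_intros assms)

lemma tendsto_bounded_mult_zero:
  fixes c X :: "nat \<Rightarrow> complex"
  assumes "X \<longlonglongrightarrow> 0" "\<And>n. norm (c n) \<le> 1"
  shows "(\<lambda>n. c n * X n) \<longlonglongrightarrow> 0"
proof (rule Lim_null_comparison[OF _ tendsto_norm_zero[OF assms(1)]])
  show "\<forall>\<^sub>F n in sequentially. norm (c n * X n) \<le> norm (X n)"
    using assms(2) by (intro always_eventually allI) (simp add: norm_mult mult_left_le_one_le)
qed

text \<open>The factor \<open>c n\<close> oscillates without a limit, hence the difference.\<close>

lemma tendsto_dform_frozen:
  fixes M :: "complex^'m^'m" and a r :: "nat \<Rightarrow> complex^'m" and c :: "nat \<Rightarrow> real"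
  assumes "2 \<le> q" "norm w = 1" "a \<longlonglongrightarrow> w" "r \<longlonglongrightarrow> 0" "\<And>n. \<bar>c n\<bar> \<le> 1"
  shows "(\<lambda>n. of_real (weight q (norm (a n))) * dform M b b' (sgn (a n)) (r n + c n *\<^sub>R l)
      - of_real ((c n)\<^sup>2) * dform M b b' w l) \<longlonglongrightarrow> 0"
proof -
  define B where "B v x y = cprod (M *v twist b v x) (twist b' v y)" for v x y
  define v where "v n = sgn (a n)" for n
  define W where "W n = complex_of_real (weight q (norm (a n)))" for n
  have "w \<noteq> 0" using assms(2) by auto
  then have "v \<longlonglongrightarrow> sgn w"
    unfolding v_def by (intro tendsto_intros assms)
  then have v: "v \<longlonglongrightarrow> w"
    using assms(2) by (simp add: sgn_div_norm)
  have "(\<lambda>n. weight q (norm (a n))) \<longlonglongrightarrow> weight q (norm w)"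
    by (rule continuous_on_tendsto_compose[OF continuous_on_weight[OF assms(1)]])
      (auto intro!: tendsto_intros assms)
  then have "W \<longlonglongrightarrow> of_real (weight q (norm w))"
    unfolding W_def by (intro tendsto_intros)
  then have W: "W \<longlonglongrightarrow> 1"
    using assms(2) by simp
  have c: "norm (complex_of_real (c n)) \<le> 1" "norm (complex_of_real ((c n)\<^sup>2)) \<le> 1" for n
    using assms(5)[of n] by (simp_all add: norm_power abs_square_le_1)
  have "(\<lambda>n. W n * B (v n) (r n) (r n)) \<longlonglongrightarrow> 1 * B w 0 0"
    unfolding B_def by (intro tendsto_intros W v assms)
  then have 1: "(\<lambda>n. W n * B (v n) (r n) (r n)) \<longlonglongrightarrow> 0"
    by (simp add: B_def cprod_def)
  have "(\<lambda>n. W n * (B (v n) (r n) l + B (v n) l (r n))) \<longlonglongrightarrow> 1 * (B w 0 l + B w l 0)"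
    unfolding B_def by (intro tendsto_intros W v assms)
  then have "(\<lambda>n. W n * (B (v n) (r n) l + B (v n) l (r n))) \<longlonglongrightarrow> 0"
    by (simp add: B_def cprod_def)
  then have 2: "(\<lambda>n. of_real (c n) * (W n * (B (v n) (r n) l + B (v n) l (r n)))) \<longlonglongrightarrow> 0"
    by (rule tendsto_bounded_mult_zero) (rule c)
  have "(\<lambda>n. W n * B (v n) l l - B w l l) \<longlonglongrightarrow> 1 * B w l l - B w l l"
    unfolding B_def by (intro tendsto_intros W v assms)
  then have "(\<lambda>n. W n * B (v n) l l - B w l l) \<longlonglongrightarrow> 0"
    by simp
  then have 3: "(\<lambda>n. of_real ((c n)\<^sup>2) * (W n * B (v n) l l - B w l l)) \<longlonglongrightarrow> 0"
    by (rule tendsto_bounded_mult_zero) (rule c)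
  have "W n * dform M b b' (v n) (r n + c n *\<^sub>R l) - of_real ((c n)\<^sup>2) * dform M b b' w l =
     W n * B (v n) (r n) (r n) + of_real (c n) * (W n * (B (v n) (r n) l + B (v n) l (r n)))
     + of_real ((c n)\<^sup>2) * (W n * B (v n) l l - B w l l)" for n
    unfolding dform_def twist_add twist_scaleR cprod_add_left cprod_add_right
      cprod_scaleR_left cprod_scaleR_right B_def
    by (simp add: algebra_simps power2_eq_square)
  then show ?thesis
    using tendsto_add[OF tendsto_add[OF 1 2] 3] unfolding W_def v_def by simp
qed

text \<open>With N = n + 1, the oscillation has amplitude 1/N and frequency N^2: the perturbation
  disappears in the limit while the h-th derivative grows like N. Using \<open>Suc n\<close> keeps N
  positive.\<close>

definition osc :: "(real^'n \<Rightarrow> real) \<Rightarrow> complex^'m \<Rightarrow> complex^'m \<Rightarrow> 'n \<Rightarrow> (real \<Rightarrow> real) \<Rightarrow> nat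
    \<Rightarrow> real^'n \<Rightarrow> complex^'m" where
  "osc \<eta> w l h \<sigma> n x = \<eta> x *\<^sub>R (w + (\<sigma> ((real (Suc n))\<^sup>2 * x $ h) / real (Suc n)) *\<^sub>R l)"

lemma osc_has_derivative:
  fixes \<eta> :: "real^'n \<Rightarrow> real" and x :: "real^'n" and n :: nat
  assumes "(\<eta> has_derivative (\<lambda>y. g \<bullet> y)) (at x)" "\<And>t. (\<sigma> has_real_derivative \<sigma>' t) (at t)"
  defines "N \<equiv> real (Suc n)"
  shows "(osc \<eta> w l h \<sigma> n has_derivative
    (\<lambda>y. (g \<bullet> y) *\<^sub>R (w + (\<sigma> (N\<^sup>2 * x $ h) / N) *\<^sub>R l) + (\<eta> x * N * \<sigma>' (N\<^sup>2 * x $ h) * y $ h) *\<^sub>R l)) (at x)"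
proof -
  have N: "N > 0" by (simp add: N_def)
  have "((\<lambda>x. N\<^sup>2 * x $ h) has_derivative (\<lambda>y. N\<^sup>2 * y $ h)) (at x)"
    by (intro bounded_linear_imp_has_derivative bounded_linear_const_mult bounded_linear_vec_nth)
  from has_derivative_compose[OF this assms(2)[unfolded has_field_derivative_def]]
  have "((\<lambda>x. \<sigma> (N\<^sup>2 * x $ h)) has_derivative (\<lambda>y. \<sigma>' (N\<^sup>2 * x $ h) * (N\<^sup>2 * y $ h))) (at x)" .
  from has_derivative_add[OF has_derivative_const
      has_derivative_scaleR_left[OF has_derivative_mult_left[OF this, of "1 / N"], of l], of w]
  have "((\<lambda>x. w + (\<sigma> (N\<^sup>2 * x $ h) / N) *\<^sub>R l) has_derivative
      (\<lambda>y. (\<sigma>' (N\<^sup>2 * x $ h) * N * y $ h) *\<^sub>R l)) (at x)"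
    using N by (simp add: power2_eq_square mult.assoc)
  from has_derivative_scaleR[OF assms(1) this] show ?thesis
    unfolding osc_def[abs_def] N_def[symmetric]
    by (rule has_derivative_eq_rhs) (simp add: fun_eq_iff algebra_simps)
qed

lemma partial_osc:
  fixes \<eta> :: "real^'n \<Rightarrow> real" and x :: "real^'n" and n :: nat
  assumes "(\<eta> has_derivative (\<lambda>y. g \<bullet> y)) (at x)" "\<And>t. (\<sigma> has_real_derivative \<sigma>' t) (at t)"
  defines "N \<equiv> real (Suc n)"
  shows "partial k (osc \<eta> w l h \<sigma> n) x = g $ k *\<^sub>R (w + (\<sigma> (N\<^sup>2 * x $ h) / N) *\<^sub>R l)
      + (if k = h then N * (\<eta> x * \<sigma>' (N\<^sup>2 * x $ h)) else 0) *\<^sub>R l"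
  unfolding partial_eq[OF osc_has_derivative[OF assms(1,2)]] N_def
  by (auto simp: inner_axis, simp_all add: axis_def algebra_simps)

lemma osc_in_C01:
  fixes \<eta> :: "real^'n \<Rightarrow> real"
  assumes "C1_fun \<eta>" "compact K" "K \<subseteq> \<Omega>" "\<And>x. x \<notin> K \<Longrightarrow> \<eta> x = 0"
    and "\<And>t. (\<sigma> has_real_derivative \<sigma>' t) (at t)" "continuous_on UNIV \<sigma>'"
  shows "osc \<eta> w l h \<sigma> n \<in> C01 \<Omega>"
proof -
  obtain g where g: "continuous_on UNIV g" "\<And>x. (\<eta> has_derivative (\<lambda>y. g x \<bullet> y)) (at x)"
    using assms(1) by (metis C1_funE)
  have \<sigma>: "continuous_on UNIV \<sigma>"
    using assms(5) by (meson DERIV_isCont continuous_at_imp_continuous_on)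
  let ?u = "osc \<eta> w l h \<sigma> n"
  have "{x. ?u x \<noteq> 0} \<subseteq> K"
    using assms(4) by (auto simp: osc_def)
  then have "closure {x. ?u x \<noteq> 0} \<subseteq> K"
    using assms(2) by (simp add: closure_minimal compact_imp_closed)
  moreover from this have "compact (closure {x. ?u x \<noteq> 0})"
    using assms(2) by (metis closed_closure compact_Int_closed inf.absorb2)
  moreover have "?u differentiable (at x)" for x
    using osc_has_derivative[OF g(2) assms(5)] unfolding differentiable_def by blast
  moreover have "continuous_on UNIV (partial k ?u)" for k
    unfolding partial_osc[OF g(2) assms(5), abs_def]
    by (cases "k = h") (auto intro!: continuous_intros g C1_fun_continuous[OF assms(1)]
        continuous_on_compose2[OF \<sigma>] continuous_on_compose2[OF assms(6)])
  ultimately show ?thesis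
    using assms(3) by (auto simp: C01_def)
qed

text \<open>A zero of a nonnegative function is a minimum. Hence test functions built from \<eta>
  have vanishing derivatives wherever \<eta> vanishes.\<close>

lemma gradient_zero:
  assumes "(\<eta> has_derivative (\<lambda>y. g \<bullet> y)) (at x)" "\<And>y. 0 \<le> \<eta> y" "\<eta> x = (0::real)"
  shows "g = 0"
proof -
  have "(\<lambda>y. g \<bullet> y) = (\<lambda>y. 0)"
    using has_derivative_local_min[OF assms(1)] assms(2,3) by auto
  then have "g \<bullet> g = 0" by metis
  then show ?thesis by simp
qed

text \<open>Each of the two energies, divided by N^2, behaves like the limit expression times the
  square of \<sigma>'. These squares need not converge individually, but for sin and cos they add up
  to 1.\<close>

lemma osc_energy_limit:
  fixes \<eta> :: "real^'n \<Rightarrow> real" and A :: "'n \<Rightarrow> real^'n \<Rightarrow> complex^'m^'m"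
  assumes "1 < p" "norm w = 1" "(\<eta> has_derivative (\<lambda>y. g \<bullet> y)) (at x)" "\<And>y. 0 \<le> \<eta> y"
  defines "q \<equiv> dual_exp p"
  shows "(\<lambda>n. of_real (1 / (real (Suc n))\<^sup>2) *
      (energy p A (osc \<eta> w l h sin n) x + energy p A (osc \<eta> w l h cos n) x))
    \<longlonglongrightarrow> of_real (weight q (\<eta> x) * (\<eta> x)\<^sup>2) * dform (A h x) (left_exp p) (right_exp p) w l"
proof (cases "\<eta> x = 0")
  case True
  have "g = 0"
    by (rule gradient_zero[OF assms(3,4) True])
  then have "partial k (osc \<eta> w l h sin n) x = 0" "partial k (osc \<eta> w l h cos n) x = 0" for k n
    unfolding partial_osc[OF assms(3) DERIV_sin] partial_osc[OF assms(3) DERIV_cos] by (simp_all add: True)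
  then show ?thesis
    by (simp add: energy_def dform_def cprod_def True)
next
  case False
  then have \<eta>: "\<eta> x > 0" using assms(4)[of x] by simp
  have q: "2 \<le> q" unfolding q_def by (rule dual_exp_ge_2[OF assms(1)])
  let ?D = "\<lambda>k. dform (A k x) (left_exp p) (right_exp p)"
  define N where "N n = real (Suc n)" for n
  have N: "N n > 0" for n by (simp add: N_def)
  have N_lim: "(\<lambda>n. 1 / N n) \<longlonglongrightarrow> 0"
    unfolding N_def by (rule LIMSEQ_Suc[OF lim_1_over_n])
  \<comment> \<open>The asymptotics for one oscillating profile \<sigma>, stated as a difference
    because the second term need not converge.\<close>
  have single: "(\<lambda>n. of_real (1 / (N n)\<^sup>2) * energy p A (osc \<eta> w l h \<sigma> n) x
      - of_real (weight q (\<eta> x) * (\<eta> x)\<^sup>2 * (\<sigma>' ((N n)\<^sup>2 * x $ h))\<^sup>2) * ?D h w l) \<longlonglongrightarrow> 0"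
    if \<sigma>: "\<And>t. (\<sigma> has_real_derivative \<sigma>' t) (at t)" "\<And>t. \<bar>\<sigma> t\<bar> \<le> 1" "\<And>t. \<bar>\<sigma>' t\<bar> \<le> 1" for \<sigma> \<sigma>'
  proof -
    define a where "a n = w + (\<sigma> ((N n)\<^sup>2 * x $ h) / N n) *\<^sub>R l" for n
    \<comment> \<open>After division by N, the k-th derivative splits into \<open>r k n\<close>,
      which comes from the gradient of \<eta> and tends to 0, and a bounded multiple of l, which is
      present only for k = h.\<close>
    define r where "r k n = (g $ k / N n) *\<^sub>R a n" for k n
    define c where "c k n = (if k = h then \<sigma>' ((N n)\<^sup>2 * x $ h) else 0)" for k n
    have "(\<lambda>n. \<sigma> ((N n)\<^sup>2 * x $ h) / N n) \<longlonglongrightarrow> 0"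
    proof (rule Lim_null_comparison[OF _ N_lim])
      show "\<forall>\<^sub>F n in sequentially. norm (\<sigma> ((N n)\<^sup>2 * x $ h) / N n) \<le> 1 / N n"
        using \<sigma>(2) by (intro always_eventually allI) (simp add: abs_of_pos[OF N] divide_right_mono less_imp_le[OF N])
    qed
    then have "a \<longlonglongrightarrow> w + 0 *\<^sub>R l"
      unfolding a_def by (intro tendsto_intros)
    then have a: "a \<longlonglongrightarrow> w" by simp
    have "(\<lambda>n. (g $ k * (1 / N n)) *\<^sub>R a n) \<longlonglongrightarrow> (g $ k * 0) *\<^sub>R w" for k
      by (intro tendsto_intros a N_lim)
    then have r: "r k \<longlonglongrightarrow> 0" for k
      by (simp add: r_def[abs_def])
    have part: "partial k (osc \<eta> w l h \<sigma> n) x = N n *\<^sub>R (r k n + c k n *\<^sub>R (\<eta> x *\<^sub>R l))" for k n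
      unfolding partial_osc[OF assms(3) \<sigma>(1)] N_def[symmetric] a_def[symmetric] r_def c_def
      using N[of n] by (simp add: algebra_simps)
    have osc: "osc \<eta> w l h \<sigma> n x = \<eta> x *\<^sub>R a n" for n
      by (simp add: osc_def a_def N_def)
    have "of_real (1 / (N n)\<^sup>2) * energy p A (osc \<eta> w l h \<sigma> n) x
      - of_real (weight q (\<eta> x) * (\<eta> x)\<^sup>2 * (\<sigma>' ((N n)\<^sup>2 * x $ h))\<^sup>2) * ?D h w l =
      (\<Sum>k\<in>UNIV. of_real (weight q (\<eta> x)) * (of_real (weight q (norm (a n))) * ?D k (sgn (a n)) (r k n + c k n *\<^sub>R (\<eta> x *\<^sub>R l))
        - of_real ((c k n)\<^sup>2) * ?D k w (\<eta> x *\<^sub>R l)))" (is "?L = ?R") for n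
    proof -
      \<comment> \<open>As \<open>\<eta> x\<close> is positive, the weight factorizes and the
        direction of u is that of \<open>a n\<close>. The factor N^2 produced by the quadratic form
        cancels 1/N^2.\<close>
      have "of_real (1 / (N n)\<^sup>2) * energy p A (osc \<eta> w l h \<sigma> n) x =
        (\<Sum>k\<in>UNIV. of_real (weight q (\<eta> x)) * (of_real (weight q (norm (a n))) * ?D k (sgn (a n)) (r k n + c k n *\<^sub>R (\<eta> x *\<^sub>R l))))"
        unfolding energy_def part osc dform_scaleR q_def[symmetric] sum_distrib_left
        using \<eta> N[of n] by (intro sum.cong refl) (simp add: weight_mult sgn_scaleR)
      moreover have "(\<Sum>k\<in>UNIV. of_real ((c k n)\<^sup>2) * ?D k w (\<eta> x *\<^sub>R l)) = of_real ((\<sigma>' ((N n)\<^sup>2 * x $ h))\<^sup>2) * ?D h w (\<eta> x *\<^sub>R l)"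
        by (subst sum.remove[of _ h]) (auto simp: c_def intro!: sum.neutral)
      ultimately show ?thesis
        unfolding right_diff_distrib sum_subtractf
        by (simp add: sum_distrib_left[symmetric] dform_scaleR)
    qed
    moreover have "(\<lambda>n. \<Sum>k\<in>UNIV. of_real (weight q (\<eta> x)) * (of_real (weight q (norm (a n))) * ?D k (sgn (a n)) (r k n + c k n *\<^sub>R (\<eta> x *\<^sub>R l))
        - of_real ((c k n)\<^sup>2) * ?D k w (\<eta> x *\<^sub>R l))) \<longlonglongrightarrow> (\<Sum>k\<in>(UNIV::'n set). of_real (weight q (\<eta> x)) * 0)"
      by (intro tendsto_sum tendsto_mult tendsto_const tendsto_dform_frozen[OF q assms(2) a r])
        (auto simp: c_def \<sigma>)
    ultimately show ?thesis by simp
  qed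
  have "(\<lambda>n. (of_real (1 / (N n)\<^sup>2) * energy p A (osc \<eta> w l h sin n) x
      - of_real (weight q (\<eta> x) * (\<eta> x)\<^sup>2 * (cos ((N n)\<^sup>2 * x $ h))\<^sup>2) * ?D h w l) +
     (of_real (1 / (N n)\<^sup>2) * energy p A (osc \<eta> w l h cos n) x
      - of_real (weight q (\<eta> x) * (\<eta> x)\<^sup>2 * (- sin ((N n)\<^sup>2 * x $ h))\<^sup>2) * ?D h w l)) \<longlonglongrightarrow> 0 + 0"
    by (intro tendsto_add single DERIV_sin DERIV_cos) auto
  moreover have "(of_real (1 / (N n)\<^sup>2) * energy p A (osc \<eta> w l h sin n) x
      - of_real (weight q (\<eta> x) * (\<eta> x)\<^sup>2 * (cos ((N n)\<^sup>2 * x $ h))\<^sup>2) * ?D h w l) +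
     (of_real (1 / (N n)\<^sup>2) * energy p A (osc \<eta> w l h cos n) x
      - of_real (weight q (\<eta> x) * (\<eta> x)\<^sup>2 * (- sin ((N n)\<^sup>2 * x $ h))\<^sup>2) * ?D h w l) =
     of_real (1 / (N n)\<^sup>2) * (energy p A (osc \<eta> w l h sin n) x + energy p A (osc \<eta> w l h cos n) x)
     - of_real (weight q (\<eta> x) * (\<eta> x)\<^sup>2) * ?D h w l" for n
  proof -
    have eq: "complex_of_real (weight q (\<eta> x) * (\<eta> x)\<^sup>2 * (cos ((N n)\<^sup>2 * x $ h))\<^sup>2) + of_real (weight q (\<eta> x) * (\<eta> x)\<^sup>2 * (- sin ((N n)\<^sup>2 * x $ h))\<^sup>2)
      = of_real (weight q (\<eta> x) * (\<eta> x)\<^sup>2)"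
      unfolding of_real_add[symmetric] distrib_left[symmetric] by simp
    have "(e * X - c1 * d) + (e * Y - c2 * d) = e * (X + Y) - (c1 + c2) * d" for e X Y c1 c2 d :: complex
      by (simp add: algebra_simps)
    then show ?thesis
      unfolding eq[symmetric] .
  qed
  ultimately show ?thesis
    by (simp add: Lim_null[symmetric] N_def LIM_zero_cancel)
qed

text \<open>A bound independent of n, for dominated convergence: |u| is at most 1 + |l| and each
  partial derivative is at most N times a constant, so the quadratic form contributes N^2.\<close>

lemma osc_energy_bound:
  fixes \<eta> :: "real^'n \<Rightarrow> real" and x :: "real^'n" and n :: nat and A :: "'n \<Rightarrow> real^'n \<Rightarrow> complex^'m^'m"
  assumes "1 < p" "norm w = 1" "(\<eta> has_derivative (\<lambda>y. g \<bullet> y)) (at x)" "0 \<le> \<eta> x" "\<eta> x \<le> 1" "norm g \<le> G"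
    and \<sigma>: "\<And>t. (\<sigma> has_real_derivative \<sigma>' t) (at t)" "\<And>t. \<bar>\<sigma> t\<bar> \<le> 1" "\<And>t. \<bar>\<sigma>' t\<bar> \<le> 1"
  defines "N \<equiv> real (Suc n)"
  shows "norm (of_real (1 / N\<^sup>2) * energy p A (osc \<eta> w l h \<sigma> n) x) \<le>
    weight (dual_exp p) (1 + norm l) * ((1 + \<bar>left_exp p\<bar>) * (1 + \<bar>right_exp p\<bar>) * (G * (1 + norm l) + norm l)\<^sup>2)
     * (\<Sum>k\<in>UNIV. \<Sum>i\<in>UNIV. \<Sum>j\<in>UNIV. norm (A k x $ i $ j))"
proof -
  have q: "2 \<le> dual_exp p" by (rule dual_exp_ge_2[OF assms(1)])
  have N: "1 \<le> N" by (simp add: N_def)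
  have G: "0 \<le> G" using assms(6) norm_ge_zero order_trans by blast
  define B where "B = G * (1 + norm l) + norm l"
  define a where "a = w + (\<sigma> (N\<^sup>2 * x $ h) / N) *\<^sub>R l"
  define C where "C = weight (dual_exp p) (1 + norm l) * ((1 + \<bar>left_exp p\<bar>) * (1 + \<bar>right_exp p\<bar>) * B\<^sup>2)"
  let ?u = "osc \<eta> w l h \<sigma> n"
  have "\<bar>\<sigma> (N\<^sup>2 * x $ h) / N\<bar> \<le> 1"
    using \<sigma>(2)[of "N\<^sup>2 * x $ h"] N by simp
  then have "\<bar>\<sigma> (N\<^sup>2 * x $ h) / N\<bar> * norm l \<le> 1 * norm l"
    by (rule mult_right_mono) simp
  then have a: "norm a \<le> 1 + norm l"
    unfolding a_def by (intro norm_triangle_le) (simp add: assms(2))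
  have "norm (?u x) \<le> 1 * (1 + norm l)"
    unfolding osc_def N_def[symmetric] a_def[symmetric] norm_scaleR
    using assms(4,5) a by (intro mult_mono) auto
  then have W: "weight (dual_exp p) (norm (?u x)) \<le> weight (dual_exp p) (1 + norm l)"
    by (intro weight_mono q) auto
  have part: "norm (partial k ?u x) \<le> N * B" for k
  proof -
    have "norm (g $ k *\<^sub>R a) \<le> G * (1 + norm l)"
      unfolding norm_scaleR real_norm_def using a assms(6) component_le_norm_cart[of g k] G
      by (intro mult_mono) auto
    also have "\<dots> \<le> N * (G * (1 + norm l))"
      using mult_right_mono[OF N, of "G * (1 + norm l)"] G by simp
    finally have 1: "norm (g $ k *\<^sub>R a) \<le> N * (G * (1 + norm l))" .
    have "\<bar>\<eta> x * \<sigma>' (N\<^sup>2 * x $ h)\<bar> \<le> 1"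
      using \<sigma>(3)[of "N\<^sup>2 * x $ h"] assms(4,5) by (simp add: abs_mult mult_le_one)
    then have "\<bar>if k = h then N * (\<eta> x * \<sigma>' (N\<^sup>2 * x $ h)) else 0\<bar> \<le> N"
      using N by (simp add: abs_mult[of N])
    then have "norm ((if k = h then N * (\<eta> x * \<sigma>' (N\<^sup>2 * x $ h)) else 0) *\<^sub>R l) \<le> N * norm l"
      unfolding norm_scaleR by (intro mult_right_mono) auto
    with 1 have "norm (partial k ?u x) \<le> N * (G * (1 + norm l)) + N * norm l"
      unfolding partial_osc[OF assms(3) \<sigma>(1)] N_def[symmetric] a_def[symmetric]
      by (intro order_trans[OF norm_triangle_ineq] add_mono)
    then show ?thesis
      by (simp add: B_def algebra_simps)
  qed
  have "norm (of_real (weight (dual_exp p) (norm (?u x))) * dform (A k x) (left_exp p) (right_exp p) (sgn (?u x)) (partial k ?u x))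
     \<le> N\<^sup>2 * (C * (\<Sum>i\<in>UNIV. \<Sum>j\<in>UNIV. norm (A k x $ i $ j)))" for k
  proof -
    let ?S = "\<Sum>i\<in>UNIV. \<Sum>j\<in>UNIV. norm (A k x $ i $ j)"
    have S: "0 \<le> ?S" by (intro sum_nonneg) auto
    have "norm (dform (A k x) (left_exp p) (right_exp p) (sgn (?u x)) (partial k ?u x))
      \<le> ?S * ((1 + \<bar>left_exp p\<bar>) * (1 + \<bar>right_exp p\<bar>) * (norm (partial k ?u x))\<^sup>2)"
      by (rule norm_dform_le) (simp add: norm_sgn)
    also have "\<dots> \<le> ?S * ((1 + \<bar>left_exp p\<bar>) * (1 + \<bar>right_exp p\<bar>) * (N * B)\<^sup>2)"
      using S part[of k] by (intro mult_left_mono power_mono) auto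
    finally have "weight (dual_exp p) (norm (?u x)) * norm (dform (A k x) (left_exp p) (right_exp p) (sgn (?u x)) (partial k ?u x))
      \<le> weight (dual_exp p) (1 + norm l) * (?S * ((1 + \<bar>left_exp p\<bar>) * (1 + \<bar>right_exp p\<bar>) * (N * B)\<^sup>2))"
      by (intro mult_mono W weight_nonneg) auto
    then show ?thesis
      by (simp add: norm_mult weight_nonneg C_def power_mult_distrib algebra_simps)
  qed
  then have "norm (energy p A ?u x) \<le> (\<Sum>k\<in>UNIV. N\<^sup>2 * (C * (\<Sum>i\<in>UNIV. \<Sum>j\<in>UNIV. norm (A k x $ i $ j))))"
    unfolding energy_def by (intro sum_norm_le)
  then have "norm (energy p A ?u x) \<le> N\<^sup>2 * (C * (\<Sum>k\<in>UNIV. \<Sum>i\<in>UNIV. \<Sum>j\<in>UNIV. norm (A k x $ i $ j)))"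
    by (simp only: sum_distrib_left)
  then show ?thesis
    unfolding C_def[symmetric] B_def[symmetric] using N
    by (simp add: norm_mult norm_divide norm_power divide_simps mult.commute)
qed

section \<open>Measurability of the integrand and passage to the limit in the forms\<close>

lemma borel_measurable_vec_nth [measurable]:
  "f \<in> borel_measurable M \<Longrightarrow> (\<lambda>x. f x $ i) \<in> borel_measurable M"
  by (rule borel_measurable_continuous_on[where f="\<lambda>v. v $ i"]) (auto intro!: continuous_intros)

lemma borel_measurable_cnj [measurable]:
  "f \<in> borel_measurable M \<Longrightarrow> (\<lambda>x. cnj (f x)) \<in> borel_measurable M"
  by (rule borel_measurable_continuous_on[where f=cnj]) (auto intro!: continuous_intros)

lemma borel_measurable_sgn_vec [measurable]:
  fixes f :: "'a \<Rightarrow> 'b::euclidean_space"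
  shows "f \<in> borel_measurable M \<Longrightarrow> (\<lambda>x. sgn (f x)) \<in> borel_measurable M"
  unfolding sgn_div_norm by measurable

lemma borel_measurable_twist [measurable]:
  fixes f g :: "'a \<Rightarrow> 'b::euclidean_space"
  shows "f \<in> borel_measurable M \<Longrightarrow> g \<in> borel_measurable M \<Longrightarrow> (\<lambda>x. twist c (f x) (g x)) \<in> borel_measurable M"
  unfolding twist_def
  by (intro borel_measurable_add borel_measurable_scaleR borel_measurable_times
      borel_measurable_const borel_measurable_inner)

lemma borel_measurable_dform:
  fixes M :: "'a \<Rightarrow> complex^'m^'m"
  assumes [measurable]: "\<And>i j. (\<lambda>x. M x $ i $ j) \<in> borel_measurable N"
    "f \<in> borel_measurable N" "g \<in> borel_measurable N"
  shows "(\<lambda>x. dform (M x) a b (f x) (g x)) \<in> borel_measurable N"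
  unfolding dform_def cprod_mv by measurable

text \<open>Serves to move an indicator onto the matrix, whose entries are controlled only after
  restriction to a set.\<close>

lemma scaleR_dform: "r *\<^sub>R dform M a b w l = dform (r *\<^sub>R M) a b w l"
  by (simp add: dform_def cprod_mv scaleR_sum_right)

lemma borel_measurable_energy:
  fixes A :: "'n \<Rightarrow> real^'n \<Rightarrow> complex^'m^'m"
  assumes A: "\<And>h i j. (\<lambda>x. indicator \<Omega> x *\<^sub>R A h x $ i $ j) \<in> borel_measurable lebesgue"
    and u: "u \<in> C01 \<Omega>"
  shows "(\<lambda>x. indicator \<Omega> x *\<^sub>R energy p A u x) \<in> borel_measurable lebesgue"
proof -
  have 1: "u \<in> borel_measurable borel"
    using u by (intro borel_measurable_continuous_onI)
      (auto simp: C01_def intro!: continuous_at_imp_continuous_on differentiable_imp_continuous_within)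
  have 2: "partial h u \<in> borel_measurable borel" for h
    using u by (intro borel_measurable_continuous_onI) (auto simp: C01_def)
  have [measurable]: "(\<lambda>x. sgn (u x)) \<in> borel_measurable lebesgue" "partial h u \<in> borel_measurable lebesgue"
    "(\<lambda>x. weight (dual_exp p) (norm (u x))) \<in> borel_measurable lebesgue" for h
    using 1 2 by (auto intro!: measurable_completion simp: weight_def)
  have D: "(\<lambda>x. dform (indicat_real \<Omega> x *\<^sub>R A h x) (left_exp p) (right_exp p) (sgn (u x)) (partial h u x))
      \<in> borel_measurable lebesgue" for h
    by (rule borel_measurable_dform) (use A in auto)
  have "indicator \<Omega> x *\<^sub>R energy p A u x = (\<Sum>h\<in>UNIV. of_real (weight (dual_exp p) (norm (u x)))
      * dform (indicat_real \<Omega> x *\<^sub>R A h x) (left_exp p) (right_exp p) (sgn (u x)) (partial h u x))" for x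
    by (simp add: energy_def scaleR_sum_right scaleR_dform[symmetric])
  then show ?thesis
    using D by simp
qed

text \<open>The forms at the sine and cosine test functions have nonnegative real parts. Their sum
  divided by N^2 converges to the stated integral by dominated convergence.\<close>

lemma cutoff_integral_nonneg:
  fixes \<Omega> :: "(real^'n) set" and A :: "'n \<Rightarrow> real^'n \<Rightarrow> complex^'m^'m" and \<eta> :: "real^'n \<Rightarrow> real"
  assumes "open \<Omega>" "1 < p" and A: "\<And>h i j. locally_integrable_on (\<lambda>x. A h x $ i $ j) \<Omega>"
    and diss: "Lp_dissipative p \<Omega> A" and w: "norm w = 1"
    and \<eta>: "C1_fun \<eta>" "\<And>x. 0 \<le> \<eta> x" "\<And>x. \<eta> x \<le> 1"
    and K: "compact K" "K \<subseteq> \<Omega>" "\<And>x. x \<notin> K \<Longrightarrow> \<eta> x = 0"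
  shows "0 \<le> (\<integral>x. weight (dual_exp p) (\<eta> x) * (\<eta> x)\<^sup>2
      * Re (dform (A h x) (left_exp p) (right_exp p) w l) \<partial>lebesgue)"
proof -
  obtain g where g: "continuous_on UNIV g" "\<And>x. (\<eta> has_derivative (\<lambda>y. g x \<bullet> y)) (at x)"
    using \<eta>(1) by (metis C1_funE)
  have g0: "g x = 0" if "x \<notin> K" for x
    by (rule gradient_zero[OF g(2) \<eta>(2) K(3)[OF that]])
  have "bounded (g ` K)"
    using g(1) K(1) by (intro compact_imp_bounded compact_continuous_image) (auto intro: continuous_on_subset)
  then obtain G0 where "\<forall>y\<in>g ` K. norm y \<le> G0"
    unfolding bounded_iff by blast
  then have G: "norm (g x) \<le> \<bar>G0\<bar>" for x
    using g0[of x] by (cases "x \<in> K") force+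
  let ?u = "\<lambda>\<sigma> n. osc \<eta> w l h \<sigma> n"
  let ?c = "\<lambda>n. complex_of_real (1 / (real (Suc n))\<^sup>2)"
  define C where "C = weight (dual_exp p) (1 + norm l) *
      ((1 + \<bar>left_exp p\<bar>) * (1 + \<bar>right_exp p\<bar>) * (\<bar>G0\<bar> * (1 + norm l) + norm l)\<^sup>2)"
  \<comment> \<open>The majorant: the constant of \<open>osc_energy_bound\<close> times the sum of
    all entry norms, cut off to the compact set K, where local integrability applies.\<close>
  define H where "H x = indicator K x * (C * (\<Sum>k\<in>UNIV. \<Sum>i\<in>UNIV. \<Sum>j\<in>UNIV. norm (A k x $ i $ j)))" for x
  have H_eq: "H = (\<lambda>x. C * (\<Sum>k\<in>UNIV. \<Sum>i\<in>UNIV. \<Sum>j\<in>UNIV. norm (indicat_real K x *\<^sub>R A k x $ i $ j)))"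
  proof
    show "H x = C * (\<Sum>k\<in>UNIV. \<Sum>i\<in>UNIV. \<Sum>j\<in>UNIV. norm (indicat_real K x *\<^sub>R A k x $ i $ j))" for x
      by (cases "x \<in> K") (simp_all add: H_def)
  qed
  have "integrable lebesgue (\<lambda>x. indicat_real K x *\<^sub>R A k x $ i $ j)" for k i j
    using A K(1,2) unfolding locally_integrable_on_def set_integrable_def by blast
  then have H: "integrable lebesgue H"
    unfolding H_eq
    by (intro integrable_mult_right Bochner_Integration.integrable_sum integrable_norm)
  have meas\<Omega>: "(\<lambda>x. indicator \<Omega> x *\<^sub>R A h x $ i $ j) \<in> borel_measurable lebesgue" for h i j
    using A[of h i j] by (intro borel_measurable_of_compact_pieces assms(1)) (auto simp: locally_integrable_on_def)
  have single: "norm (indicator \<Omega> x *\<^sub>R (?c n * energy p A (?u \<sigma> n) x)) \<le> H x"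
     "integrable lebesgue (\<lambda>x. indicator \<Omega> x *\<^sub>R (?c n * energy p A (?u \<sigma> n) x))"
     "0 \<le> Re (\<integral>x. indicator \<Omega> x *\<^sub>R (?c n * energy p A (?u \<sigma> n) x) \<partial>lebesgue)"
    if \<sigma>: "\<And>t. (\<sigma> has_real_derivative \<sigma>' t) (at t)" "\<And>t. \<bar>\<sigma> t\<bar> \<le> 1" "\<And>t. \<bar>\<sigma>' t\<bar> \<le> 1"
      "continuous_on UNIV \<sigma>'" for \<sigma> \<sigma>' n x
  proof -
    have u: "?u \<sigma> n \<in> C01 \<Omega>"
      by (rule osc_in_C01[OF \<eta>(1) K(1,2) K(3) \<sigma>(1,4)])
    have bound: "norm (indicator \<Omega> x *\<^sub>R (?c n * energy p A (?u \<sigma> n) x)) \<le> H x" for x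
    proof (cases "x \<in> K")
      case True
      have "norm (?c n * energy p A (?u \<sigma> n) x) \<le> H x"
        using osc_energy_bound[OF assms(2) w g(2) \<eta>(2) \<eta>(3) G \<sigma>(1-3), where x=x and n=n and A=A and l=l and h=h] True
        by (simp only: H_def C_def indicator_simps mult_1_left)
      then show ?thesis
        using True K(2) by (auto simp: indicator_def)
    next
      case False
      \<comment> \<open>Off K both \<eta> and its gradient vanish, so the integrand is 0
        there.\<close>
      have "partial k (?u \<sigma> n) x = 0" for k
        unfolding partial_osc[OF g(2) \<sigma>(1)] g0[OF False] K(3)[OF False] by simp
      then have "energy p A (?u \<sigma> n) x = 0"
        by (simp add: energy_def dform_def cprod_def)
      then show ?thesis
        using False by (simp add: H_def)
    qed
    show "norm (indicator \<Omega> x *\<^sub>R (?c n * energy p A (?u \<sigma> n) x)) \<le> H x"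
      by (rule bound)
    have eq: "indicator \<Omega> x *\<^sub>R (?c n * energy p A (?u \<sigma> n) x) = ?c n * (indicator \<Omega> x *\<^sub>R energy p A (?u \<sigma> n) x)" for x
      by simp
    show "integrable lebesgue (\<lambda>x. indicator \<Omega> x *\<^sub>R (?c n * energy p A (?u \<sigma> n) x))"
    proof (rule Bochner_Integration.integrable_bound[OF H])
      show "(\<lambda>x. indicator \<Omega> x *\<^sub>R (?c n * energy p A (?u \<sigma> n) x)) \<in> borel_measurable lebesgue"
        unfolding eq using borel_measurable_energy[OF meas\<Omega> u] by (intro borel_measurable_times borel_measurable_const)
      show "AE x in lebesgue. norm (indicator \<Omega> x *\<^sub>R (?c n * energy p A (?u \<sigma> n) x)) \<le> norm (H x)"
        unfolding real_norm_def by (intro AE_I2 order_trans[OF bound abs_ge_self])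
    qed
    have "0 \<le> Re (LINT x:\<Omega>|lebesgue. energy p A (?u \<sigma> n) x)"
      using diss u unfolding Lp_dissipative_iff_energy[OF assms(2)] by blast
    then show "0 \<le> Re (\<integral>x. indicator \<Omega> x *\<^sub>R (?c n * energy p A (?u \<sigma> n) x) \<partial>lebesgue)"
      unfolding eq set_lebesgue_integral_def integral_mult_right_zero
      by (subst times_complex.sel(1), subst Re_complex_of_real, subst Im_complex_of_real) simp
  qed
  let ?f = "\<lambda>n x. indicator \<Omega> x *\<^sub>R (?c n * (energy p A (?u sin n) x + energy p A (?u cos n) x))"
  let ?F = "\<lambda>x. indicator \<Omega> x *\<^sub>R (of_real (weight (dual_exp p) (\<eta> x) * (\<eta> x)\<^sup>2)
    * dform (A h x) (left_exp p) (right_exp p) w l)"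
  have f: "?f n x = indicator \<Omega> x *\<^sub>R (?c n * energy p A (?u sin n) x) + indicator \<Omega> x *\<^sub>R (?c n * energy p A (?u cos n) x)" for n x
    by (simp only: distrib_left scaleR_add_right)
  have s: "\<bar>sin t\<bar> \<le> 1" "\<bar>cos t\<bar> \<le> 1" "\<bar>- sin t\<bar> \<le> 1" for t :: real
    by auto
  have cont: "continuous_on UNIV (\<lambda>t::real. cos t)" "continuous_on UNIV (\<lambda>t::real. - sin t)"
    by (auto intro!: continuous_intros)
  note sin_case = single[OF DERIV_sin s(1,2) cont(1)] and cos_case = single[OF DERIV_cos s(2,3) cont(2)]
  have int_f: "integrable lebesgue (?f n)" for n
    unfolding f by (intro Bochner_Integration.integrable_add sin_case cos_case)
  have lim: "(\<lambda>n. ?f n x) \<longlonglongrightarrow> ?F x" for x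
    by (intro tendsto_scaleR tendsto_const osc_energy_limit[OF assms(2) w g(2) \<eta>(2)])
  have conv: "(\<lambda>n. \<integral>x. ?f n x \<partial>lebesgue) \<longlonglongrightarrow> (\<integral>x. ?F x \<partial>lebesgue)" and intF: "integrable lebesgue ?F"
  proof -
    have F_meas: "?F \<in> borel_measurable lebesgue"
      by (rule borel_measurable_LIMSEQ_metric[OF borel_measurable_integrable[OF int_f] lim])
    have bd: "AE x in lebesgue. norm (?f n x) \<le> 2 * H x" for n
      unfolding f mult_2
      by (intro AE_I2 order_trans[OF norm_triangle_ineq] add_mono sin_case(1) cos_case(1))
    have H2: "integrable lebesgue (\<lambda>x. 2 * H x)" using H by simp
    show "(\<lambda>n. \<integral>x. ?f n x \<partial>lebesgue) \<longlonglongrightarrow> (\<integral>x. ?F x \<partial>lebesgue)"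
      by (rule integral_dominated_convergence[OF F_meas borel_measurable_integrable[OF int_f] H2 AE_I2[OF lim] bd])
    show "integrable lebesgue ?F"
      by (rule integrable_dominated_convergence[OF F_meas borel_measurable_integrable[OF int_f] H2 AE_I2[OF lim] bd])
  qed
  have "0 \<le> Re (\<integral>x. ?f n x \<partial>lebesgue)" for n
    unfolding f
    by (subst Bochner_Integration.integral_add[OF sin_case(2) cos_case(2)])
      (use sin_case(3) cos_case(3) in simp)
  then have "0 \<le> Re (\<integral>x. ?F x \<partial>lebesgue)"
    by (intro LIMSEQ_le_const[OF tendsto_Re[OF conv]]) auto
  also have "Re (\<integral>x. ?F x \<partial>lebesgue) = (\<integral>x. Re (?F x) \<partial>lebesgue)"
    using intF by (rule integral_Re[symmetric])
  also have "(\<lambda>x. Re (?F x)) = (\<lambda>x. weight (dual_exp p) (\<eta> x) * (\<eta> x)\<^sup>2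
      * Re (dform (A h x) (left_exp p) (right_exp p) w l))"
  proof
    fix x
    show "Re (?F x) = weight (dual_exp p) (\<eta> x) * (\<eta> x)\<^sup>2 * Re (dform (A h x) (left_exp p) (right_exp p) w l)"
      using K(2) K(3)[of x] by (cases "x \<in> K") (auto simp: indicator_def)
  qed
  finally show ?thesis .
qed

subsection \<open>The algebraic criterion\<close>

lemma continuous_on_dform:
  "continuous_on S (\<lambda>(l, w). dform M a b w l)"
  unfolding dform_def cprod_mv twist_def split_beta' by (intro continuous_intros)

lemma closed_dform_nonneg: "closed {(l, w). 0 \<le> Re (dform M a b w l)}"
proof -
  have "closed {y. 0 \<le> Re ((\<lambda>(l, w). dform M a b w l) y)}"
    by (intro closed_Collect_le continuous_intros continuous_on_dform)
  then show ?thesis by (simp add: split_beta')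
qed

lemma set_integrable_dform:
  fixes A :: "'n \<Rightarrow> real^'n \<Rightarrow> complex^'m^'m"
  assumes "\<And>i j. set_integrable lebesgue K (\<lambda>x. A h x $ i $ j)"
  shows "set_integrable lebesgue K (\<lambda>x. dform (A h x) a b w l)"
  using assms unfolding set_integrable_def scaleR_dform unfolding dform_def cprod_mv
  by (intro Bochner_Integration.integrable_sum integrable_mult_left) simp

text \<open>For fixed \<lambda> and \<omega> the cut-off integrals give the inequality outside a
  null set that depends on both. Countable density and continuity then provide one null set for all
  of them.\<close>

lemma Lp_dissipative_imp_AE:
  fixes \<Omega> :: "(real^'n) set" and A :: "'n \<Rightarrow> real^'n \<Rightarrow> complex^'m^'m"
  assumes "open \<Omega>" "1 < p" and A: "\<And>h i j. locally_integrable_on (\<lambda>x. A h x $ i $ j) \<Omega>"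
    and diss: "Lp_dissipative p \<Omega> A"
  shows "AE x in lebesgue. x \<in> \<Omega> \<longrightarrow>
    (\<forall>l w. norm w = 1 \<longrightarrow> 0 \<le> Re (dform (A h x) (- (1 - 2/p)) (1 - 2/p) w l))"
proof -
  have q: "2 \<le> dual_exp p" by (rule dual_exp_ge_2[OF assms(2)])
  have single: "AE x in lebesgue. x \<in> \<Omega> \<longrightarrow> 0 \<le> Re (dform (A h x) (- (1 - 2/p)) (1 - 2/p) w l)"
    if w: "norm w = 1" for l w
  proof -
    \<comment> \<open>The oscillation direction is l0 rather than l, so that the limit of the forms
      is exactly P at l.\<close>
    obtain l0 where l0: "l = twist ((dual_exp p - 2) / 2) w l0"
      using twist_surj[OF assms(2) w] .
    have eq: "dform (A h x) (- (1 - 2/p)) (1 - 2/p) w l = dform (A h x) (left_exp p) (right_exp p) w l0" for x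
      unfolding l0 by (rule dform_exp) (use assms(2) w in auto)
    show ?thesis
      unfolding eq
    proof (rule AE_nonneg_of_cutoff_integrals[where \<theta>="\<lambda>t. weight (dual_exp p) t * t\<^sup>2"])
      show "set_integrable lebesgue K (\<lambda>x. Re (dform (A h x) (left_exp p) (right_exp p) w l0))"
        if "compact K" "K \<subseteq> \<Omega>" for K
      proof -
        have "set_integrable lebesgue K (\<lambda>x. dform (A h x) (left_exp p) (right_exp p) w l0)"
          using A that by (intro set_integrable_dform) (auto simp: locally_integrable_on_def)
        from integrable_Re[OF this[unfolded set_integrable_def]] show ?thesis
          by (simp add: set_integrable_def)
      qed
      show "continuous_on {0..1} (\<lambda>t. weight (dual_exp p) t * t\<^sup>2)"
        by (intro continuous_intros continuous_on_subset[OF continuous_on_weight[OF q]]) auto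
    qed (use cutoff_integral_nonneg[OF assms(1,2) A diss w] assms(1) in auto)
  qed
  \<comment> \<open>T is countable and dense in the set of pairs with unit second component. The
    inequality defines a closed set of pairs, so it passes from T to its closure.\<close>
  obtain T :: "((complex^'m) \<times> (complex^'m)) set"
    where T: "countable T" "T \<subseteq> {(l, w). norm w = 1}" "{(l, w). norm w = 1} \<subseteq> closure T"
    by (rule separable)
  have "AE x in lebesgue. \<forall>y\<in>T. x \<in> \<Omega> \<longrightarrow> 0 \<le> Re (dform (A h x) (- (1 - 2/p)) (1 - 2/p) (snd y) (fst y))"
    using T(2) by (subst AE_ball_countable[OF T(1)]) (auto simp del: minus_diff_eq intro!: single)
  then show ?thesis
  proof eventually_elim
    case (elim x)
    show ?case
    proof (intro impI allI)
      fix l w :: "complex^'m"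
      assume x: "x \<in> \<Omega>" and w: "norm w = 1"
      let ?S = "{(l, w). 0 \<le> Re (dform (A h x) (- (1 - 2/p)) (1 - 2/p) w l)}"
      have "T \<subseteq> ?S" using elim x by auto
      then have "closure T \<subseteq> ?S"
        by (rule closure_minimal[OF _ closed_dform_nonneg])
      moreover have "(l, w) \<in> closure T"
        using T(3) w by auto
      ultimately show "0 \<le> Re (dform (A h x) (- (1 - 2/p)) (1 - 2/p) w l)"
        by auto
    qed
  qed
qed

text \<open>Where u is nonzero, each summand is the weight times P at \<omega> = u/|u| and a twisted
  derivative. Where u = 0 there is no direction \<omega>, and the weight is 0 unless p = 2.\<close>

lemma energy_nonneg:
  assumes "1 < p"
    and nn: "\<And>h l w. norm w = 1 \<Longrightarrow> 0 \<le> Re (dform (A h x) (- (1 - 2/p)) (1 - 2/p) w l)"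
  shows "0 \<le> Re (energy p A u x)"
proof -
  have "0 \<le> weight (dual_exp p) (norm (u x)) * Re (dform (A h x) (left_exp p) (right_exp p) (sgn (u x)) (partial h u x))" for h
  proof (cases "u x = 0")
    case True
    show ?thesis
    proof (cases "p = 2")
      case p: True
      \<comment> \<open>For p = 2 the twists have coefficient 0 and the form does not depend on
        \<omega>, so an arbitrary unit vector serves to instantiate the hypothesis.\<close>
      have "0 \<le> Re (dform (A h x) 0 0 (axis undefined 1) (partial h u x))"
        using nn[of "axis undefined 1" h "partial h u x"] p by simp
      then show ?thesis
        using True p by (simp add: weight_def left_exp_def right_exp_def dual_exp_def dform_def)
    next
      case False
      then have "dual_exp p \<noteq> 2"
        using assms(1) by (auto simp: dual_exp_def field_simps)
      with True show ?thesis
        by (simp add: weight_def)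
    qed
  next
    case False
    then have "norm (sgn (u x)) = 1" by (simp add: norm_sgn)
    then show ?thesis
      using assms(1) by (subst dform_exp[symmetric]) (auto simp del: minus_diff_eq intro!: mult_nonneg_nonneg weight_nonneg nn)
  qed
  then show ?thesis
    unfolding energy_def by (auto intro!: sum_nonneg)
qed

lemma AE_imp_Lp_dissipative:
  fixes \<Omega> :: "(real^'n) set" and A :: "'n \<Rightarrow> real^'n \<Rightarrow> complex^'m^'m"
  assumes "1 < p"
    and AE: "\<And>h. AE x in lebesgue. x \<in> \<Omega> \<longrightarrow>
      (\<forall>l w. norm w = 1 \<longrightarrow> 0 \<le> Re (dform (A h x) (- (1 - 2/p)) (1 - 2/p) w l))"
  shows "Lp_dissipative p \<Omega> A"
  unfolding Lp_dissipative_iff_energy[OF assms(1)]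
proof
  fix u :: "real^'n \<Rightarrow> complex^'m"
  have "AE x in lebesgue. \<forall>h. x \<in> \<Omega> \<longrightarrow>
      (\<forall>l w. norm w = 1 \<longrightarrow> 0 \<le> Re (dform (A h x) (- (1 - 2/p)) (1 - 2/p) w l))"
    using AE by (subst AE_all_countable) (auto simp: countable_finite)
  then have nn: "AE x in lebesgue. 0 \<le> Re (indicator \<Omega> x *\<^sub>R energy p A u x)"
  proof eventually_elim
    case (elim x)
    then show ?case
      using energy_nonneg[OF assms(1), of A x u] by (cases "x \<in> \<Omega>") auto
  qed
  show "0 \<le> Re (LINT x:\<Omega>|lebesgue. energy p A u x)"
  proof (cases "integrable lebesgue (\<lambda>x. indicator \<Omega> x *\<^sub>R energy p A u x)")
    case True
    show ?thesis
      unfolding set_lebesgue_integral_def integral_Re[OF True, symmetric]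
      by (rule integral_nonneg_AE[OF nn])
  next
    case False
    \<comment> \<open>The integral of a non-integrable function is 0 by convention.\<close>
    then show ?thesis
      by (simp add: set_lebesgue_integral_def not_integrable_integral_eq)
  qed
qed

subsection \<open>Null sets of the base measure\<close>

lemma sigma_finite_lebesgue: "sigma_finite_measure (lebesgue :: 'a::euclidean_space measure)"
proof
  have "emeasure lebesgue (cball (0::'a) (real n)) \<noteq> \<infinity>" for n
    using fmeasurableD2[OF lmeasurable_cball[of "0::'a" "real n"]] by simp
  moreover have "(\<Union>n. cball (0::'a) (real n)) = UNIV"
    by (auto intro: real_arch_simple)
  ultimately show "\<exists>A::'a set set. countable A \<and> A \<subseteq> sets lebesgue \<and> \<Union>A = space lebesgue \<and> (\<forall>a\<in>A. emeasure lebesgue a \<noteq> \<infinity>)"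
    by (intro exI[of _ "range (\<lambda>n. cball 0 (real n))"]) (auto intro: fmeasurableD lmeasurable_cball)
qed

lemma space_sphere_measure [simp]: "space sphere_measure = sphere 0 1"
  and sets_sphere_measure [measurable_cong]: "sets sphere_measure = sets (restrict_space borel (sphere 0 1))"
  by (simp_all add: sphere_measure_def space_scale_measure space_restrict_space)

lemma sgn_measurable_sphere:
  "sgn \<in> restrict_space lborel (ball 0 1 - {0}) \<rightarrow>\<^sub>M restrict_space borel (sphere (0::'a::euclidean_space) 1)"
proof (rule measurable_restrict_space2)
  show "sgn \<in> space (restrict_space lborel (ball 0 1 - {0})) \<rightarrow> sphere (0::'a) 1"
    by (auto simp: space_restrict_space norm_sgn)
  have "sgn \<in> borel_measurable (borel :: 'a measure)"
    unfolding sgn_div_norm[abs_def] by measurable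
  then show "sgn \<in> borel_measurable (restrict_space lborel (ball (0::'a) 1 - {0}))"
    by (intro measurable_restrict_space1) simp
qed

lemma finite_sphere_measure: "finite_measure (sphere_measure :: 'a::euclidean_space measure)"
proof
  let ?R = "restrict_space lborel (ball (0::'a) 1 - {0})"
  have "emeasure ?R (space ?R) = emeasure lborel (ball (0::'a) 1 - {0})"
    by (subst emeasure_restrict_space) (auto simp: space_restrict_space)
  also have "\<dots> \<le> emeasure lborel (ball (0::'a) 1)"
    by (intro emeasure_mono) auto
  also have "\<dots> < \<infinity>"
    by (rule emeasure_bounded_finite) simp
  finally have "emeasure ?R (space ?R) < \<infinity>" .
  moreover have "sphere (0::'a) 1 \<in> sets (restrict_space borel (sphere 0 1))"
    by (simp add: sets_restrict_space_iff)
  then have "emeasure (distr ?R (restrict_space borel (sphere 0 1)) sgn) (sphere 0 1)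
      = emeasure ?R (sgn -` sphere 0 1 \<inter> space ?R)"
    by (rule emeasure_distr[OF sgn_measurable_sphere])
  ultimately have "emeasure (distr ?R (restrict_space borel (sphere 0 1)) sgn) (sphere 0 1) < \<infinity>"
    using order_le_less_trans[OF emeasure_space] by metis
  then show "emeasure sphere_measure (space (sphere_measure :: 'a measure)) \<noteq> \<infinity>"
    by (simp add: sphere_measure_def space_scale_measure space_restrict_space ennreal_mult_eq_top_iff)
qed

lemma open_AE_empty:
  fixes V :: "'a::euclidean_space set"
  assumes "open V" "AE v in lborel. v \<notin> V"
  shows "V = {}"
proof -
  have "V \<in> null_sets lborel"
    using assms by (subst AE_iff_null_sets) auto
  then have "negligible V"
    unfolding negligible_iff_null_sets by (rule null_sets_completionI)
  then show ?thesis
    using open_not_negligible[OF assms(1)] by blast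
qed

text \<open>The sphere measure has full support: the complement of F pulls back under
  \<open>sgn\<close> to an open null subset of the punctured ball, which is therefore empty, and a
  unit vector w is \<open>sgn\<close> of w/2.\<close>

lemma AE_sphere_measure_closed:
  fixes F :: "'a::euclidean_space set"
  assumes "AE w in sphere_measure. w \<in> F" "closed F" "norm w = 1"
  shows "w \<in> F"
proof -
  let ?D = "distr (restrict_space lborel (ball (0::'a) 1 - {0})) (restrict_space borel (sphere 0 1)) sgn"
  have "AE w in ?D. w \<in> F"
    \<comment> \<open>Scaling by the positive dimension does not change the null sets.\<close>
    using assms(1) by (auto simp: sphere_measure_def eventually_ae_filter null_sets_def space_scale_measure)
  from AE_distrD[OF sgn_measurable_sphere this]
  have AE: "AE v in lborel. v \<in> ball 0 1 - {0} \<longrightarrow> sgn v \<in> F"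
    by (subst (asm) AE_restrict_space_iff) auto
  have "continuous_on (ball 0 1 - {0::'a}) sgn"
    unfolding sgn_div_norm by (auto intro!: continuous_intros)
  then have "open ((ball 0 1 - {0}) \<inter> sgn -` (- F))"
    using assms(2) by (intro continuous_open_preimage) auto
  moreover have "AE v in lborel. v \<notin> (ball 0 1 - {0}) \<inter> sgn -` (- F)"
    using AE by eventually_elim auto
  ultimately have "(ball 0 1 - {0}) \<inter> sgn -` (- F) = {}"
    by (rule open_AE_empty)
  moreover have "(1/2) *\<^sub>R w \<in> ball 0 1 - {0}" "sgn ((1/2) *\<^sub>R w) = w"
    using assms(3) by (auto simp: sgn_scaleR sgn_div_norm)
  ultimately show ?thesis by blast
qed

text \<open>Fubini reduces the left side to almost every fibre. In a closed fibre, almost everywhere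
  is the same as everywhere, because Lebesgue measure and the sphere measure have full
  support.\<close>

lemma AE_base_measure_iff:
  fixes \<Omega> :: "(real^'n) set" and F :: "real^'n \<Rightarrow> ((complex^'m) \<times> (complex^'m)) set"
  assumes "open \<Omega>" and F: "\<And>x. closed (F x)"
  shows "(AE y in base_measure \<Omega>. snd y \<in> F (fst y)) \<longleftrightarrow>
    (AE x in lebesgue. x \<in> \<Omega> \<longrightarrow> (\<forall>l w. norm w = 1 \<longrightarrow> (l, w) \<in> F x))"
proof -
  let ?S = "sphere_measure :: (complex^'m) measure"
  have \<Omega>: "\<Omega> \<in> sets lebesgue" using assms(1) by auto
  interpret S: finite_measure ?S by (rule finite_sphere_measure)
  interpret LS: pair_sigma_finite "lborel :: (complex^'m) measure" ?S
    by (intro pair_sigma_finite.intro sigma_finite_lborel S.sigma_finite_measure_axioms)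
  interpret pair_sigma_finite "lebesgue_on \<Omega>" "lborel \<Otimes>\<^sub>M ?S"
    by (intro pair_sigma_finite.intro sigma_finite_measure_restrict_space sigma_finite_lebesgue \<Omega>
        sigma_finite_pair_measure sigma_finite_lborel S.sigma_finite_measure_axioms)
  \<comment> \<open>Closedness is used twice: in w for almost every fixed l, and then in l for every
    fixed unit vector w.\<close>
  have fibre: "\<forall>l w. norm w = 1 \<longrightarrow> (l, w) \<in> F x" if "AE y in lborel \<Otimes>\<^sub>M ?S. y \<in> F x" for x
  proof -
    have "AE l in lborel. AE w in ?S. (l, w) \<in> F x"
      using LS.AE_pair[OF that] .
    then have "AE l in lborel. \<forall>w. norm w = 1 \<longrightarrow> (l, w) \<in> F x"
    proof eventually_elim
      case (elim l)
      have "closed (Pair l -` F x)"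
        by (intro closed_vimage F continuous_intros)
      then show ?case
        using AE_sphere_measure_closed[of "Pair l -` F x"] elim by auto
    qed
    then have "AE l in lborel. l \<notin> - ((\<lambda>l. (l, w)) -` F x)" if "norm w = 1" for w
      by eventually_elim (use that in auto)
    moreover have "open (- ((\<lambda>l. (l, w)) -` F x))" for w
      unfolding open_closed[symmetric] by (intro open_Compl closed_vimage F continuous_intros)
    ultimately have "- ((\<lambda>l. (l, w)) -` F x) = {}" if "norm w = 1" for w
      using that open_AE_empty by blast
    then show ?thesis by blast
  qed
  have "AE x in lebesgue_on \<Omega>. \<forall>l w. norm w = 1 \<longrightarrow> (l, w) \<in> F x"
    if "AE y in base_measure \<Omega>. snd y \<in> F (fst y)"
    using AE_pair[OF that[unfolded base_measure_def]] by eventually_elim (use fibre in simp)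
  moreover have "AE y in base_measure \<Omega>. snd y \<in> F (fst y)"
    if AE: "AE x in lebesgue_on \<Omega>. \<forall>l w. norm w = 1 \<longrightarrow> (l, w) \<in> F x"
  proof -
    obtain N where N: "{x \<in> space (lebesgue_on \<Omega>). \<not> (\<forall>l w. norm w = 1 \<longrightarrow> (l, w) \<in> F x)} \<subseteq> N"
      "N \<in> null_sets (lebesgue_on \<Omega>)"
      using AE unfolding eventually_ae_filter by blast
    \<comment> \<open>The exceptional set lies in a cylinder over a null set of points x.\<close>
    have "N \<times> space (lborel \<Otimes>\<^sub>M ?S) \<in> null_sets (base_measure \<Omega>)"
      unfolding base_measure_def by (rule M2.times_in_null_sets1[OF N(2) sets.top])
    moreover have "{y \<in> space (base_measure \<Omega>). snd y \<notin> F (fst y)} \<subseteq> N \<times> space (lborel \<Otimes>\<^sub>M ?S)"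
      using N(1) by (fastforce simp: base_measure_def space_pair_measure space_restrict_space)
    ultimately show ?thesis by (rule AE_I')
  qed
  moreover have "(AE x in lebesgue_on \<Omega>. \<forall>l w. norm w = 1 \<longrightarrow> (l, w) \<in> F x) \<longleftrightarrow>
    (AE x in lebesgue. x \<in> \<Omega> \<longrightarrow> (\<forall>l w. norm w = 1 \<longrightarrow> (l, w) \<in> F x))"
    using \<Omega> by (subst AE_restrict_space_iff) auto
  ultimately show ?thesis by blast
qed

lemma locally_integrable_scale_op:
  assumes "\<And>h i j. locally_integrable_on (\<lambda>x. A h x $ i $ j) \<Omega>"
  shows "locally_integrable_on (\<lambda>x. scale_op z A h x $ i $ j) \<Omega>"
  using assms unfolding locally_integrable_on_def scale_op_def by (auto intro!: set_integrable_mult_right)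

text \<open>Applied below both to A and to \<open>scale_op z A\<close>. The fibres are the closed
  sets of pairs where the real part of \<open>dform\<close> is nonnegative, which makes the
  fibrewise and the almost-everywhere conditions equivalent.\<close>

theorem Lp_dissipative_iff_P_nonneg:
  fixes \<Omega> :: "(real^'n) set" and A :: "'n \<Rightarrow> real^'n \<Rightarrow> complex^'m^'m"
  assumes "open \<Omega>" "1 < p" "\<And>h i j. locally_integrable_on (\<lambda>x. A h x $ i $ j) \<Omega>"
  shows "Lp_dissipative p \<Omega> A \<longleftrightarrow> (\<forall>h. AE y in base_measure \<Omega>. 0 \<le> P_fun p A h y)"
proof -
  have "(AE y in base_measure \<Omega>. 0 \<le> P_fun p A h y) \<longleftrightarrow> (AE x in lebesgue. x \<in> \<Omega> \<longrightarrow>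
      (\<forall>l w. norm w = 1 \<longrightarrow> 0 \<le> Re (dform (A h x) (- (1 - 2/p)) (1 - 2/p) w l)))" for h
  proof -
    have "0 \<le> P_fun p A h y \<longleftrightarrow>
        snd y \<in> {(l, w). 0 \<le> Re (dform (A h (fst y)) (- (1 - 2/p)) (1 - 2/p) w l)}" for y
      by (cases y) (simp add: P_fun_eq)
    then show ?thesis
      using AE_base_measure_iff[OF assms(1) closed_dform_nonneg, of "A h" "\<lambda>_. - (1 - 2/p)" "\<lambda>_. 1 - 2/p"]
      by (simp del: minus_diff_eq)
  qed
  note eq = this
  show ?thesis
    unfolding eq
  proof
    assume "Lp_dissipative p \<Omega> A"
    from Lp_dissipative_imp_AE[OF assms this]
    show "\<forall>h. AE x in lebesgue. x \<in> \<Omega> \<longrightarrow>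
      (\<forall>l w. norm w = 1 \<longrightarrow> 0 \<le> Re (dform (A h x) (- (1 - 2/p)) (1 - 2/p) w l))"
      by (rule allI)
  next
    assume "\<forall>h. AE x in lebesgue. x \<in> \<Omega> \<longrightarrow>
      (\<forall>l w. norm w = 1 \<longrightarrow> 0 \<le> Re (dform (A h x) (- (1 - 2/p)) (1 - 2/p) w l))"
    from AE_imp_Lp_dissipative[OF assms(2) spec[OF this]] show "Lp_dissipative p \<Omega> A" .
  qed
qed

subsection \<open>Essential bounds of the quotient\<close>

lemma measurable_base_measure_coeff:
  fixes \<Omega> :: "(real^'n) set" and A :: "'n \<Rightarrow> real^'n \<Rightarrow> complex^'m^'m"
  assumes "open \<Omega>" "\<And>h i j. locally_integrable_on (\<lambda>x. A h x $ i $ j) \<Omega>"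
  shows "(\<lambda>y. dform (A h (fst y)) a b (snd (snd y)) (fst (snd y)))
    \<in> borel_measurable (base_measure \<Omega> :: ((real^'n) \<times> (complex^'m) \<times> (complex^'m)) measure)"
proof (rule borel_measurable_dform)
  fix i j
  have "(\<lambda>x. A h x $ i $ j) \<in> borel_measurable (lebesgue_on \<Omega>)"
    using assms(1) borel_measurable_of_compact_pieces[OF assms(1), of "\<lambda>x. A h x $ i $ j"] assms(2)[of h i j]
    by (subst borel_measurable_restrict_space_iff) (auto simp: locally_integrable_on_def)
  then show "(\<lambda>y. A h (fst y) $ i $ j)
      \<in> borel_measurable (base_measure \<Omega> :: ((real^'n) \<times> (complex^'m) \<times> (complex^'m)) measure)"
    unfolding base_measure_def by (rule measurable_compose[OF measurable_fst])
next
  have "(\<lambda>w. w) \<in> sphere_measure \<rightarrow>\<^sub>M (borel :: (complex^'m) measure)"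
    by (subst measurable_cong_sets[OF sets_sphere_measure refl]) (rule measurable_restrict_space1, simp)
  then show "(\<lambda>y. snd (snd y))
      \<in> borel_measurable (base_measure \<Omega> :: ((real^'n) \<times> (complex^'m) \<times> (complex^'m)) measure)"
    unfolding base_measure_def by measurable
  show "(\<lambda>y. fst (snd y))
      \<in> borel_measurable (base_measure \<Omega> :: ((real^'n) \<times> (complex^'m) \<times> (complex^'m)) measure)"
    unfolding base_measure_def by measurable
qed

lemma measurable_PQ:
  fixes \<Omega> :: "(real^'n) set" and A :: "'n \<Rightarrow> real^'n \<Rightarrow> complex^'m^'m"
  assumes "open \<Omega>" "\<And>h i j. locally_integrable_on (\<lambda>x. A h x $ i $ j) \<Omega>"
  shows "P_fun p A h \<in> borel_measurable (base_measure \<Omega>)"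
    and "Q_fun p A h \<in> borel_measurable (base_measure \<Omega>)"
proof -
  have P: "P_fun p A h = (\<lambda>y. Re (dform (A h (fst y)) (- (1 - 2/p)) (1 - 2/p) (snd (snd y)) (fst (snd y))))"
    and Q: "Q_fun p A h = (\<lambda>y. Im (dform (A h (fst y)) (- (1 - 2/p)) (1 - 2/p) (snd (snd y)) (fst (snd y))))"
    by (auto simp: fun_eq_iff P_fun_eq Q_fun_eq)
  note [measurable] = measurable_base_measure_coeff[OF assms]
  show "P_fun p A h \<in> borel_measurable (base_measure \<Omega>)" "Q_fun p A h \<in> borel_measurable (base_measure \<Omega>)"
    unfolding P Q by measurable
qed

lemma esssup_le_iff:
  assumes "f \<in> borel_measurable M"
  shows "esssup M f \<le> c \<longleftrightarrow> (AE x in M. f x \<le> c)"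
proof
  assume le: "esssup M f \<le> c"
  show "AE x in M. f x \<le> c"
    using esssup_AE[of f M] by eventually_elim (rule order_trans[OF _ le])
qed (rule esssup_I[OF assms])

lemma le_essinf_iff:
  assumes "f \<in> borel_measurable M"
  shows "c \<le> essinf M f \<longleftrightarrow> (AE x in M. c \<le> f x)"
proof -
  have "c \<le> essinf M f \<longleftrightarrow> esssup M (\<lambda>y. - f y) \<le> - c"
    using ereal_minus_le_minus[of "- c" "esssup M (\<lambda>y. - f y)"] by (simp add: essinf_def)
  also have "\<dots> \<longleftrightarrow> (AE x in M. - f x \<le> - c)"
    using assms by (intro esssup_le_iff) measurable
  finally show ?thesis
    by simp
qed

lemma Xi_eq: "Xi p \<Omega> A h = {y \<in> space (base_measure \<Omega>). 0 < (P_fun p A h y)\<^sup>2 + (Q_fun p A h y)\<^sup>2}"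
  by (auto simp: Xi_def base_measure_def space_pair_measure space_restrict_space)

lemma
  fixes \<Omega> :: "(real^'n) set" and A :: "'n \<Rightarrow> real^'n \<Rightarrow> complex^'m^'m"
  assumes "open \<Omega>" "\<And>h i j. locally_integrable_on (\<lambda>x. A h x $ i $ j) \<Omega>"
  shows AE_Xi_measure_iff: "(AE y in Xi_measure p \<Omega> A h. R y) \<longleftrightarrow>
      (AE y in base_measure \<Omega>. 0 < (P_fun p A h y)\<^sup>2 + (Q_fun p A h y)\<^sup>2 \<longrightarrow> R y)"
    and measurable_QP_ratio: "QP_ratio p A h \<in> borel_measurable (Xi_measure p \<Omega> A h)"
proof -
  note [measurable] = measurable_PQ[OF assms]
  have "Xi p \<Omega> A h \<in> sets (base_measure \<Omega>)"
    unfolding Xi_eq by measurable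
  then have "(AE y in Xi_measure p \<Omega> A h. R y) \<longleftrightarrow> (AE y in base_measure \<Omega>. y \<in> Xi p \<Omega> A h \<longrightarrow> R y)"
    unfolding Xi_measure_def by (intro AE_restrict_space_iff) (simp add: sets.Int_space_eq2)
  also have "\<dots> \<longleftrightarrow> (AE y in base_measure \<Omega>. 0 < (P_fun p A h y)\<^sup>2 + (Q_fun p A h y)\<^sup>2 \<longrightarrow> R y)"
    by (intro AE_cong) (simp add: Xi_eq)
  finally show "(AE y in Xi_measure p \<Omega> A h. R y) \<longleftrightarrow>
      (AE y in base_measure \<Omega>. 0 < (P_fun p A h y)\<^sup>2 + (Q_fun p A h y)\<^sup>2 \<longrightarrow> R y)" .
  have "QP_ratio p A h \<in> borel_measurable (base_measure \<Omega>)"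
    unfolding QP_ratio_def[abs_def] by measurable
  then show "QP_ratio p A h \<in> borel_measurable (Xi_measure p \<Omega> A h)"
    unfolding Xi_measure_def by (rule measurable_restrict_space1)
qed

text \<open>For P > 0 the quotient is finite and one multiplies by P. For P = 0 it is infinite with
  the sign of Q, so only that sign matters. If both vanish, the premise fails and the right side
  holds.\<close>

lemma ereal_quotient_bounds:
  fixes P Q c :: real
  assumes "0 \<le> P"
  shows "(0 < P\<^sup>2 + Q\<^sup>2 \<longrightarrow> ereal Q / ereal P \<le> ereal c) \<longleftrightarrow> Q \<le> c * P"
    "(0 < P\<^sup>2 + Q\<^sup>2 \<longrightarrow> ereal c \<le> ereal Q / ereal P) \<longleftrightarrow> c * P \<le> Q"
    "(0 < P\<^sup>2 + Q\<^sup>2 \<longrightarrow> ereal Q / ereal P \<le> - \<infinity>) \<longleftrightarrow> P = 0 \<and> Q \<le> 0"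
    "(0 < P\<^sup>2 + Q\<^sup>2 \<longrightarrow> \<infinity> \<le> ereal Q / ereal P) \<longleftrightarrow> P = 0 \<and> 0 \<le> Q"
proof -
  have *: "0 < P\<^sup>2 + Q\<^sup>2 \<longleftrightarrow> P \<noteq> 0 \<or> Q \<noteq> 0"
    by (simp add: sum_power2_gt_zero_iff)
  have "0 < P \<or> P = 0 \<and> Q < 0 \<or> P = 0 \<and> Q = 0 \<or> P = 0 \<and> 0 < Q"
    using assms by linarith
  then show "(0 < P\<^sup>2 + Q\<^sup>2 \<longrightarrow> ereal Q / ereal P \<le> ereal c) \<longleftrightarrow> Q \<le> c * P"
    "(0 < P\<^sup>2 + Q\<^sup>2 \<longrightarrow> ereal c \<le> ereal Q / ereal P) \<longleftrightarrow> c * P \<le> Q"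
    "(0 < P\<^sup>2 + Q\<^sup>2 \<longrightarrow> ereal Q / ereal P \<le> - \<infinity>) \<longleftrightarrow> P = 0 \<and> Q \<le> 0"
    "(0 < P\<^sup>2 + Q\<^sup>2 \<longrightarrow> \<infinity> \<le> ereal Q / ereal P) \<longleftrightarrow> P = 0 \<and> 0 \<le> Q"
    unfolding * by (elim disjE; auto simp: field_simps)+
qed

section \<open>The inverse cotangent and arguments of complex numbers\<close>

lemma arccot_bounds: "0 \<le> arccot e" "arccot e \<le> pi"
  using arctan_ubound[of "real_of_ereal e"] arctan_lbound[of "real_of_ereal e"]
  by (auto simp: arccot_def)

lemma arccot_eq_pi_iff: "pi \<le> arccot e \<longleftrightarrow> e \<le> - \<infinity>"
  using arctan_lbound[of "real_of_ereal e"] pi_gt_zero unfolding arccot_def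
  by (cases e) (auto simp: not_le[symmetric] simp del: pi_gt_zero)

lemma arccot_eq_0_iff: "arccot e \<le> 0 \<longleftrightarrow> \<infinity> \<le> e"
  using arctan_ubound[of "real_of_ereal e"] pi_gt_zero unfolding arccot_def
  by (cases e) (auto simp: not_le[symmetric] simp del: pi_gt_zero)

text \<open>\<open>arccot\<close> inverts the decreasing function cot on (0, pi), because cot t =
  tan (pi/2 - t); being decreasing, it reverses inequalities.\<close>

lemma
  assumes "0 < t" "t < pi"
  shows le_arccot_iff: "t \<le> arccot e \<longleftrightarrow> e \<le> ereal (cos t / sin t)"
    and arccot_le_iff: "arccot e \<le> t \<longleftrightarrow> ereal (cos t / sin t) \<le> e"
proof -
  have "tan (pi / 2 - t) = cos t / sin t"
    by (simp add: tan_def cos_diff sin_diff)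
  moreover have "arctan (tan (pi / 2 - t)) = pi / 2 - t"
    using assms by (intro arctan_tan) auto
  ultimately have a: "arctan (cos t / sin t) = pi / 2 - t" by simp
  have "t \<le> pi / 2 - arctan r \<longleftrightarrow> r \<le> cos t / sin t" "pi / 2 - arctan r \<le> t \<longleftrightarrow> cos t / sin t \<le> r" for r
    using arctan_le_iff[of r "cos t / sin t"] arctan_le_iff[of "cos t / sin t" r] unfolding a by linarith+
  then show "t \<le> arccot e \<longleftrightarrow> e \<le> ereal (cos t / sin t)" "arccot e \<le> t \<longleftrightarrow> ereal (cos t / sin t) \<le> e"
    using assms by (cases e; simp add: arccot_def)+
qed

lemma arg_between_cis:
  assumes "0 < r" "- pi < t" "t < pi"
  shows "arg_between a b (of_real r * cis t) \<longleftrightarrow> a \<le> t \<and> t \<le> b"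
proof
  assume "arg_between a b (of_real r * cis t)"
  then obtain s where s: "- pi \<le> s" "s \<le> pi" "of_real r * cis t = of_real r * cis s" "a \<le> s" "s \<le> b"
    using assms(1) by (auto simp: arg_between_def norm_mult)
  then have eq: "cis t = cis s" using assms(1) by simp
  \<comment> \<open>\<open>Arg\<close> takes values in (-pi, pi], so s = -pi must be excluded before
    s can be identified with \<open>Arg (cis s)\<close>.\<close>
  have "s \<noteq> - pi"
  proof
    assume "s = - pi"
    then have "cis t = cis pi" using eq by (simp add: complex_eq_iff)
    then have "Arg (cis t) = pi" using Arg_cis[of pi] by simp
    then show False using Arg_cis[of t] assms by simp
  qed
  then have "s = Arg (cis s)"
    using s by (intro Arg_cis[symmetric]) simp
  also have "\<dots> = t"
    unfolding eq[symmetric] using assms by (intro Arg_cis) simp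
  finally have "s = t" .
  with s show "a \<le> t \<and> t \<le> b" by simp
next
  assume "a \<le> t \<and> t \<le> b"
  with assms show "arg_between a b (of_real r * cis t)"
    by (auto simp: arg_between_def norm_mult intro!: exI[of _ t])
qed

text \<open>cos s = -1 forces |s| = pi, since cos is strictly decreasing on [0, pi]; both signs are
  admissible arguments.\<close>

lemma arg_between_neg:
  assumes "0 < r"
  shows "arg_between a b (- of_real r) \<longleftrightarrow> a \<le> - pi \<and> - pi \<le> b \<or> a \<le> pi \<and> pi \<le> b"
proof
  assume "arg_between a b (- of_real r)"
  then obtain s where s: "- pi \<le> s" "s \<le> pi" "- of_real r = of_real r * cis s" "a \<le> s" "s \<le> b"
    using assms by (auto simp: arg_between_def)
  then have "cis s = - 1"
    using assms by (metis mult_cancel_left mult_minus1_right of_real_eq_0_iff less_irrefl)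
  then have "cos s = - 1"
    by (simp add: complex_eq_iff)
  then have "s = - pi \<or> s = pi"
    using s(1,2) cos_monotone_0_pi[of "\<bar>s\<bar>" pi] by (cases "\<bar>s\<bar> < pi") (auto simp: abs_if split: if_splits)
  with s show "a \<le> - pi \<and> - pi \<le> b \<or> a \<le> pi \<and> pi \<le> b" by auto
next
  assume "a \<le> - pi \<and> - pi \<le> b \<or> a \<le> pi \<and> pi \<le> b"
  then show "arg_between a b (- of_real r)"
  proof
    assume "a \<le> - pi \<and> - pi \<le> b"
    with assms show ?thesis
      unfolding arg_between_def by (intro exI[of _ "- pi"]) (simp add: complex_eq_iff)
  next
    assume "a \<le> pi \<and> pi \<le> b"
    with assms show ?thesis
      unfolding arg_between_def by (intro exI[of _ pi]) (simp add: complex_eq_iff)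
  qed
qed

section \<open>The sector of dissipativity\<close>

theorem theorem9:
  fixes \<Omega> :: "(real^'n) set"
    and p :: real
    and A :: "'n \<Rightarrow> real^'n \<Rightarrow> complex^'m^'m"
    and z :: complex
  assumes "open \<Omega>" "connected \<Omega>" "\<Omega> \<noteq> {}"
    and "1 < p"
    and "\<And>h i j. locally_integrable_on (\<lambda>x. A h x $ i $ j) \<Omega>"
    and "Lp_dissipative p \<Omega> A"
    and "\<not> (indefinite_degenerate p \<Omega> A \<and> Im z = 0 \<and> Re z < 0)"
  shows "Lp_dissipative p \<Omega> (scale_op z A) \<longleftrightarrow>
    arg_between (theta_minus p \<Omega> A) (theta_plus p \<Omega> A) z"
proof -
  let ?M = "base_measure \<Omega> :: ((real^'n) \<times> (complex^'m) \<times> (complex^'m)) measure"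
  let ?P = "P_fun p A" and ?Q = "Q_fun p A"
  define S where "S h = esssup (Xi_measure p \<Omega> A h) (QP_ratio p A h)" for h
  define I where "I h = essinf (Xi_measure p \<Omega> A h) (QP_ratio p A h)" for h
  have P: "AE y in ?M. 0 \<le> ?P h y" for h
    using assms(6) Lp_dissipative_iff_P_nonneg[of \<Omega> p A] assms(1,4,5) by simp
  have diss: "Lp_dissipative p \<Omega> (scale_op z A) \<longleftrightarrow> (\<forall>h. AE y in ?M. 0 \<le> Re z * ?P h y - Im z * ?Q h y)"
    using Lp_dissipative_iff_P_nonneg[of \<Omega> p "scale_op z A"] locally_integrable_scale_op[of A \<Omega> z] assms(1,4,5)
    by (simp add: scale_op_PQ)
  have plus: "t \<le> theta_plus p \<Omega> A \<longleftrightarrow> (\<forall>h. t \<le> arccot (S h))" for t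
    unfolding theta_plus_def S_def by (subst Min_ge_iff) auto
  have minus: "theta_minus p \<Omega> A \<le> t \<longleftrightarrow> (\<forall>h. arccot (I h) \<le> t + pi)" for t
    unfolding theta_minus_def I_def diff_le_eq by (subst Max_le_iff) auto
  \<comment> \<open>As \<open>arccot\<close> takes values in [0, pi], the sector contains 0 and lies
    within [-pi, pi].\<close>
  have bounds: "theta_minus p \<Omega> A \<le> 0" "- pi \<le> theta_minus p \<Omega> A" "0 \<le> theta_plus p \<Omega> A" "theta_plus p \<Omega> A \<le> pi"
  proof -
    show "theta_minus p \<Omega> A \<le> 0" "0 \<le> theta_plus p \<Omega> A"
      unfolding plus minus using arccot_bounds by simp_all
    show "- pi \<le> theta_minus p \<Omega> A"
      unfolding theta_minus_def using arccot_bounds(1) by (auto simp: Max_ge_iff)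
    show "theta_plus p \<Omega> A \<le> pi"
      unfolding theta_plus_def using arccot_bounds(2) by (auto simp: Min_le_iff)
  qed
  have S_le: "S h \<le> c \<longleftrightarrow> (AE y in ?M. 0 < (?P h y)\<^sup>2 + (?Q h y)\<^sup>2 \<longrightarrow> QP_ratio p A h y \<le> c)" for h c
    unfolding S_def by (subst esssup_le_iff[OF measurable_QP_ratio[of \<Omega> A, OF assms(1,5)]])
      (rule AE_Xi_measure_iff[of \<Omega> A, OF assms(1,5)])
  have le_I: "c \<le> I h \<longleftrightarrow> (AE y in ?M. 0 < (?P h y)\<^sup>2 + (?Q h y)\<^sup>2 \<longrightarrow> c \<le> QP_ratio p A h y)" for h c
    unfolding I_def by (subst le_essinf_iff[OF measurable_QP_ratio[of \<Omega> A, OF assms(1,5)]])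
      (rule AE_Xi_measure_iff[of \<Omega> A, OF assms(1,5)])
  \<comment> \<open>Dissipativity of A gives P \<ge> 0 almost everywhere, so equivalences valid for
    P \<ge> 0 may be used under the almost-everywhere quantifier.\<close>
  have AE_iff: "(AE y in ?M. R y) \<longleftrightarrow> (AE y in ?M. R' y)"
    if "\<And>y. 0 \<le> ?P h y \<Longrightarrow> R y \<longleftrightarrow> R' y" for R R' h
  proof
    show "AE y in ?M. R y \<Longrightarrow> AE y in ?M. R' y"
      using P[of h] by (auto elim!: eventually_elim2 simp: that)
    show "AE y in ?M. R' y \<Longrightarrow> AE y in ?M. R y"
      using P[of h] by (auto elim!: eventually_elim2 simp: that)
  qed
  \<comment> \<open>Essential bounds of Q/P become linear inequalities between P and Q; the infinite
    bounds below force P = 0 and a sign of Q.\<close>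
  have S_fin: "S h \<le> ereal c \<longleftrightarrow> (AE y in ?M. ?Q h y \<le> c * ?P h y)" for h c
    unfolding S_le QP_ratio_def by (intro AE_iff[of h] ereal_quotient_bounds)
  have I_fin: "ereal c \<le> I h \<longleftrightarrow> (AE y in ?M. c * ?P h y \<le> ?Q h y)" for h c
    unfolding le_I QP_ratio_def by (intro AE_iff[of h] ereal_quotient_bounds)
  have S_inf: "S h \<le> - \<infinity> \<longleftrightarrow> (AE y in ?M. ?P h y = 0 \<and> ?Q h y \<le> 0)" for h
    unfolding S_le QP_ratio_def by (intro AE_iff[of h] ereal_quotient_bounds)
  have I_inf: "\<infinity> \<le> I h \<longleftrightarrow> (AE y in ?M. ?P h y = 0 \<and> 0 \<le> ?Q h y)" for h
    unfolding le_I QP_ratio_def by (intro AE_iff[of h] ereal_quotient_bounds)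
  show ?thesis
  proof (cases "z = 0")
    case True
    then show ?thesis
      \<comment> \<open>For z = 0 every angle is an argument, and 0 lies in the sector.\<close>
      unfolding diss using bounds by (auto simp: arg_between_def intro!: exI[of _ 0])
  next
    case False
    define r where "r = cmod z"
    define t where "t = Arg z"
    have r: "0 < r" using False by (simp add: r_def)
    have z: "z = of_real r * cis t"
      using rcis_cmod_Arg[of z] by (simp add: r_def t_def rcis_def)
    have t: "- pi < t" "t \<le> pi"
      using Arg_bounded[of z] by (auto simp: t_def)
    have between: "arg_between a b z \<longleftrightarrow> a \<le> t \<and> t \<le> b" if "t < pi" for a b
      unfolding z by (rule arg_between_cis[OF r t(1) that])
    have Re_z: "Re z = r * cos t" and Im_z: "Im z = r * sin t"
      by (simp_all add: z)
    \<comment> \<open>Since the sector contains 0, positive arguments test only its upper end and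
      negative ones only its lower end. The value pi is separate because -pi is then an argument as
      well.\<close>
    consider "t = 0" | "0 < t" "t < pi" | "t < 0" | "t = pi"
      using t by linarith
    then show ?thesis
    proof cases
      case 1
      have "arg_between (theta_minus p \<Omega> A) (theta_plus p \<Omega> A) z"
        using 1 bounds between by simp
      moreover have "Lp_dissipative p \<Omega> (scale_op z A)"
        unfolding diss Re_z Im_z using 1 r P by (simp add: zero_le_mult_iff)
      ultimately show ?thesis by simp
    next
      case 2
      have s: "0 < sin t" using 2 by (rule sin_gt_zero)
      \<comment> \<open>Division by r sin t > 0 turns the criterion for z A into Q \<le> cot(t)
        P.\<close>
      have "0 \<le> Re z * ?P h y - Im z * ?Q h y \<longleftrightarrow> ?Q h y \<le> cos t / sin t * ?P h y" for h y
      proof -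
        have "Re z * ?P h y - Im z * ?Q h y = r * sin t * (cos t / sin t * ?P h y - ?Q h y)"
          using s by (simp add: Re_z Im_z field_simps)
        then show ?thesis
          using mult_le_cancel_left_pos[of "r * sin t" 0 "cos t / sin t * ?P h y - ?Q h y"] mult_pos_pos[OF r s]
          by (simp only: mult_zero_right diff_ge_0_iff_ge)
      qed
      then have "Lp_dissipative p \<Omega> (scale_op z A) \<longleftrightarrow> t \<le> theta_plus p \<Omega> A"
        unfolding diss plus le_arccot_iff[OF 2] S_fin by simp
      then show ?thesis
        using 2 bounds between by auto
    next
      case 3
      \<comment> \<open>The shift by pi moves t into the range where \<open>arccot\<close> inverts
        cot and matches the term -pi in \<open>theta_minus\<close>. The cotangent is unchanged,
        while sin t < 0 reverses the inequality.\<close>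
      have t': "0 < t + pi" "t + pi < pi" using t 3 by auto
      have s: "sin t < 0" using sin_gt_zero[OF t'] by simp
      have cot: "cos (t + pi) / sin (t + pi) = cos t / sin t" by simp
      have "0 \<le> Re z * ?P h y - Im z * ?Q h y \<longleftrightarrow> cos t / sin t * ?P h y \<le> ?Q h y" for h y
      proof -
        have "Re z * ?P h y - Im z * ?Q h y = r * (- sin t) * (?Q h y - cos t / sin t * ?P h y)"
          using s by (simp add: Re_z Im_z field_simps)
        moreover have "0 < r * (- sin t)"
          using r s by (intro mult_pos_pos) auto
        ultimately show ?thesis
          using mult_le_cancel_left_pos[of "r * (- sin t)" 0 "?Q h y - cos t / sin t * ?P h y"]
          by (simp only: mult_zero_right diff_ge_0_iff_ge)
      qed
      then have "Lp_dissipative p \<Omega> (scale_op z A) \<longleftrightarrow> theta_minus p \<Omega> A \<le> t"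
        unfolding diss minus arccot_le_iff[OF t'] cot I_fin by simp
      then show ?thesis
        using 3 bounds between pi_gt_zero by auto
    next
      case 4
      then have zr: "z = - of_real r" and neg: "Im z = 0" "Re z < 0"
        using r by (simp_all add: z)
      have "0 \<le> Re z * ?P h y - Im z * ?Q h y \<longleftrightarrow> ?P h y = 0" if "0 \<le> ?P h y" for h y
        using that neg by (auto simp: zero_le_mult_iff)
      then have 1: "Lp_dissipative p \<Omega> (scale_op z A) \<longleftrightarrow> (\<forall>h. AE y in ?M. ?P h y = 0)"
        unfolding diss by (intro all_cong1 AE_iff)
      \<comment> \<open>The argument -pi is admissible iff all P vanish and all Q are nonnegative,
        the argument pi iff all P vanish and all Q are nonpositive.\<close>
      have "arg_between (theta_minus p \<Omega> A) (theta_plus p \<Omega> A) z \<longleftrightarrow> theta_minus p \<Omega> A \<le> - pi \<or> pi \<le> theta_plus p \<Omega> A"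
        unfolding zr arg_between_neg[OF r] using bounds pi_gt_zero by auto
      also have "\<dots> \<longleftrightarrow> (\<forall>h. AE y in ?M. ?P h y = 0 \<and> 0 \<le> ?Q h y) \<or> (\<forall>h. AE y in ?M. ?P h y = 0 \<and> ?Q h y \<le> 0)"
        unfolding minus plus add.left_inverse arccot_eq_pi_iff arccot_eq_0_iff S_inf I_inf ..
      also have "\<dots> \<longleftrightarrow> (\<forall>h. AE y in ?M. ?P h y = 0) \<and>
          ((\<forall>h. AE y in ?M. 0 \<le> ?Q h y) \<or> (\<forall>h. AE y in ?M. ?Q h y \<le> 0))"
        unfolding AE_conj_iff by blast
      \<comment> \<open>If all P vanish, neither sign condition on Q could hold only in the
        degenerate situation, which is excluded for negative z.\<close>
      also have "\<dots> \<longleftrightarrow> (\<forall>h. AE y in ?M. ?P h y = 0)"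
        using assms(7) neg unfolding indefinite_degenerate_def by blast
      finally show ?thesis using 1 by simp
    qed
  qed
qed

end
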